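(* Let $\mathcal Z,\mathcal U,\mathcal D,\mathcal R$ be separable Hilbert spaces. Let $A:D(A)\subset\mathcal Z\to\mathcal Z$ be the infinitesimal generator of a strongly continuous semigroup on $\mathcal Z$, let $B\in\mathcal L(\mathcal U,\mathcal Z)$ and $H\in\mathcal L(\mathcal D,\mathcal Z)$, and let $R\in\mathcal L(\mathcal U,\mathcal R)$ be such that $R^*R$ is coercive. Consider the system $$\frac{dz(t)}{dt}=Az(t)+Bu(t)+Hd(t),\quad t\ge 0,\qquad z(0)=0,$$ with control input $u$, disturbance $d$, and regulated output $\zeta=\begin{bmatrix} z\\ Ru\end{bmatrix}$. For a controller $K$ (state feedback $\hat u(s)=K(s)\hat z(s)$), let $G_K$ denote the closed-loop transfer function from $\hat d$ to $\hat\zeta$. If $A$ is self-adjoint and strictly negative, then the problem $$\inf_K\ \|G_K\|_\infty ,$$ where the infimum is over all controllers $K$ for which the closed-loop system $G_K$ is stable, is solved by the (static) state feedback controller $$K_{\text{opt}}=(R^*R)^{-1}B^*A^{-1},$$ that is, $G_{K_{\text{opt}}}$ is stable and $\|G_{K_{\text{opt}}}\|_\infty=\inf_K\|G_K\|_\infty$; and the minimum value (the optimal attenuation) is $$\gamma_{\text{opt}}=\inf_K\|G_K\|_\infty=\left\|H^*\left(A^2+B(R^*R)^{-1}B^*\right)^{-1}H\right\|^{\frac12}.$$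
   Context: $\mathcal L(\mathcal X,\mathcal Y)$ denotes the bounded linear operators from $\mathcal X$ to $\mathcal Y$; $T^*$ denotes the adjoint of $T$; $\hat y$ denotes the Laplace transform of $y$. A self-adjoint operator $A$ on a Hilbert space $\mathcal Z$ is strictly positive (coercive) if there is $m>0$ with $\langle Az,z\rangle\ge m\|z\|^2$ for all $z\in D(A)$; $A$ is strictly negative if $-A$ is strictly positive. Let $\mathbb C_0^+=\{s\in\mathbb C:\operatorname{Re}s>0\}$. For Hilbert spaces $\mathcal D,\mathcal Y$, $H_\infty$ is the space of holomorphic functions $G:\mathbb C_0^+\to\mathcal L(\mathcal D,\mathcal Y)$ with $\|G\|_\infty:=\sup_{\operatorname{Re}s>0}\|G(s)\|<\infty$. A system is (externally) stable if, with zero initial condition, every $L_2(0,\infty)$ input gives an $L_2(0,\infty)$ output; equivalently, its transfer function belongs to $H_\infty$. A controller is a transfer function $K$, i.e. an $\mathcal L(\mathcal Z,\mathcal U)$-valued meromorphic function on $\mathbb C_0^+$ (a constant $K\in\mathcal L(\mathcal Z,\mathcal U)$ being a static state feedback), for which the loop is well-posed, meaning that $sI-A-BK(s)$ has a bounded inverse except at isolated points of $\mathbb C_0^+$. The closed-loop transfer function from $\hat d$ to $\hat\zeta$ is $$G_K(s)=\begin{bmatrix} I\\ RK(s)\end{bmatrix}\left(sI-A-BK(s)\right)^{-1}H .$$ "$G_K$ is stable" means that $G_K$ (after removing removable singularities) belongs to $H_\infty$. The operator $A^2+B(R^*R)^{-1}B^*$ has domain $D(A^2)$. The norm on $\mathcal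 Z\times\mathcal R$ is $\|(z,r)\|^2=\|z\|^2+\|r\|^2$. *)

theory Defs
  imports "HOL-Analysis.Analysis"
begin

section \<open>Complex Hilbert spaces\<close>

text \<open>
  The real inner product of the superclass is the real part of the complex one, so that norm,
  topology, operator norm and the type of bounded operators are those of the library. The complex
  inner product is linear in its first argument. A separable complex Hilbert space is a type of sort
  \<open>{complex_inner, polish_space}\<close>, i.e. complete and second countable.
\<close>

class complex_inner = real_inner +
  fixes scaleC :: "complex \<Rightarrow> 'a \<Rightarrow> 'a"  (infixr \<open>*\<^sub>C\<close> 75)
    and cinner :: "'a \<Rightarrow> 'a \<Rightarrow> complex"
  assumes scaleC_add_right: "c *\<^sub>C (x + y) = c *\<^sub>C x + c *\<^sub>C y"
    and scaleC_add_left: "(c + d) *\<^sub>C x = c *\<^sub>C x + d *\<^sub>C x"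
    and scaleC_scaleC: "c *\<^sub>C (d *\<^sub>C x) = (c * d) *\<^sub>C x"
    and scaleC_of_real: "complex_of_real r *\<^sub>C x = r *\<^sub>R x"
    and cinner_commute: "cinner x y = cnj (cinner y x)"
    and cinner_add_left: "cinner (x + y) z = cinner x z + cinner y z"
    and cinner_scaleC_left: "cinner (c *\<^sub>C x) y = c * cinner x y"
    and Re_cinner: "Re (cinner x y) = inner x y"

instantiation complex :: complex_inner
begin

definition scaleC_complex :: "complex \<Rightarrow> complex \<Rightarrow> complex" where
  "scaleC_complex c x = c * x"

definition cinner_complex :: "complex \<Rightarrow> complex \<Rightarrow> complex" where
  "cinner_complex x y = x * cnj y"

instance
  by standard
    (simp_all add: scaleC_complex_def cinner_complex_def inner_complex_def algebra_simps
      scaleR_conv_of_real)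

end

instantiation prod :: (complex_inner, complex_inner) complex_inner
begin

definition scaleC_prod :: "complex \<Rightarrow> 'a \<times> 'b \<Rightarrow> 'a \<times> 'b" where
  "scaleC_prod c x = (c *\<^sub>C fst x, c *\<^sub>C snd x)"

definition cinner_prod :: "'a \<times> 'b \<Rightarrow> 'a \<times> 'b \<Rightarrow> complex" where
  "cinner_prod x y = cinner (fst x) (fst y) + cinner (snd x) (snd y)"

instance
proof
  fix x y z :: "'a \<times> 'b" and c d :: complex and r :: real
  show "c *\<^sub>C (x + y) = c *\<^sub>C x + c *\<^sub>C y"
    by (simp add: scaleC_prod_def scaleC_add_right)
  show "(c + d) *\<^sub>C x = c *\<^sub>C x + d *\<^sub>C x"
    by (simp add: scaleC_prod_def scaleC_add_left)
  show "c *\<^sub>C (d *\<^sub>C x) = (c * d) *\<^sub>C x"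
    by (simp add: scaleC_prod_def scaleC_scaleC)
  show "complex_of_real r *\<^sub>C x = r *\<^sub>R x"
    by (simp add: scaleC_prod_def scaleC_of_real scaleR_prod_def)
  show "cinner x y = cnj (cinner y x)"
    unfolding cinner_prod_def complex_cnj_add by (metis cinner_commute)
  show "cinner (x + y) z = cinner x z + cinner y z"
    by (simp add: cinner_prod_def cinner_add_left)
  show "cinner (c *\<^sub>C x) y = c * cinner x y"
    by (simp add: cinner_prod_def scaleC_prod_def cinner_scaleC_left algebra_simps)
  show "Re (cinner x y) = inner x y"
    by (simp add: cinner_prod_def inner_prod_def Re_cinner)
qed

end

section \<open>Bounded operators\<close>

text \<open>
  The library type of bounded operators consists of the real-linear ones; \<open>cblinfun\<close> is the
  subspace of complex-linear operators.
\<close>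

definition cblinfun :: "('a::complex_inner \<Rightarrow>\<^sub>L 'b::complex_inner) set" where
  "cblinfun = {T. \<forall>c x. blinfun_apply T (c *\<^sub>C x) = c *\<^sub>C blinfun_apply T x}"

definition scaleC_blinfun ::
    "complex \<Rightarrow> ('a::complex_inner \<Rightarrow>\<^sub>L 'b::complex_inner) \<Rightarrow> 'a \<Rightarrow>\<^sub>L 'b" where
  "scaleC_blinfun c T = Blinfun (\<lambda>x. c *\<^sub>C blinfun_apply T x)"

definition cadjoint :: "('a::complex_inner \<Rightarrow>\<^sub>L 'b::complex_inner) \<Rightarrow> 'b \<Rightarrow>\<^sub>L 'a" where
  "cadjoint T = (THE S. \<forall>x y. cinner (blinfun_apply T x) y = cinner x (blinfun_apply S y))"

definition blinfun_column ::
    "('a::complex_inner \<Rightarrow>\<^sub>L 'b::complex_inner) \<Rightarrow> ('a \<Rightarrow>\<^sub>L 'c::complex_inner) \<Rightarrow> 'a \<Rightarrow>\<^sub>L ('b \<times> 'c)" where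
  "blinfun_column S T = Blinfun (\<lambda>x. (blinfun_apply S x, blinfun_apply T x))"

section \<open>Unbounded operators\<close>

text \<open>
  An operator is given by its domain \<open>D\<close> and a function whose values outside \<open>D\<close> are irrelevant.
\<close>

definition has_bounded_inverse ::
    "'a::complex_inner set \<Rightarrow> ('a \<Rightarrow> 'b::complex_inner) \<Rightarrow> bool" where
  "has_bounded_inverse D T \<longleftrightarrow> bij_betw T D UNIV \<and> bounded_linear (inv_into D T)"

definition op_inverse :: "'a::complex_inner set \<Rightarrow> ('a \<Rightarrow> 'b::complex_inner) \<Rightarrow> 'b \<Rightarrow>\<^sub>L 'a" where
  "op_inverse D T = Blinfun (inv_into D T)"

definition c0_semigroup :: "(real \<Rightarrow> 'a::complex_inner \<Rightarrow>\<^sub>L 'a) \<Rightarrow> bool" where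
  "c0_semigroup T \<longleftrightarrow>
     (\<forall>t\<ge>0. T t \<in> cblinfun) \<and> T 0 = id_blinfun \<and>
     (\<forall>s\<ge>0. \<forall>t\<ge>0. T (s + t) = T s o\<^sub>L T t) \<and>
     (\<forall>z. ((\<lambda>t. blinfun_apply (T t) z) \<longlongrightarrow> z) (at_right 0))"

definition is_generator ::
    "'a::complex_inner set \<Rightarrow> ('a \<Rightarrow> 'a) \<Rightarrow> (real \<Rightarrow> 'a \<Rightarrow>\<^sub>L 'a) \<Rightarrow> bool" where
  "is_generator D A T \<longleftrightarrow>
     D = {z. \<exists>y. ((\<lambda>t. (blinfun_apply (T t) z - z) /\<^sub>R t) \<longlongrightarrow> y) (at_right 0)} \<and>
     (\<forall>z\<in>D. ((\<lambda>t. (blinfun_apply (T t) z - z) /\<^sub>R t) \<longlongrightarrow> A z) (at_right 0))"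

text \<open>
  For a densely defined operator the set on the left-hand side of the equation is the graph of the
  adjoint, so the equation says that the adjoint has the same domain and the same values.
\<close>

definition selfadjoint_op :: "'a::complex_inner set \<Rightarrow> ('a \<Rightarrow> 'a) \<Rightarrow> bool" where
  "selfadjoint_op D A \<longleftrightarrow>
     closure D = UNIV \<and>
     {(y, w). \<forall>x\<in>D. cinner (A x) y = cinner x w} = {(y, A y) | y. y \<in> D}"

text \<open>For self-adjoint operators \<open>cinner (A z) z\<close> is real.\<close>

definition coercive_op :: "'a::complex_inner set \<Rightarrow> ('a \<Rightarrow> 'a) \<Rightarrow> bool" where
  "coercive_op D A \<longleftrightarrow> (\<exists>m>0. \<forall>z\<in>D. m * (norm z)\<^sup>2 \<le> Re (cinner (A z) z))"

definition strictly_negative_op :: "'a::complex_inner set \<Rightarrow> ('a \<Rightarrow> 'a) \<Rightarrow> bool" where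
  "strictly_negative_op D A \<longleftrightarrow> coercive_op D (\<lambda>z. - A z)"

section \<open>Operator-valued functions on the right half-plane\<close>

definition right_half_plane :: "complex set" where
  "right_half_plane = {s. 0 < Re s}"

definition op_holomorphic_on ::
    "(complex \<Rightarrow> 'a::complex_inner \<Rightarrow>\<^sub>L 'b::complex_inner) \<Rightarrow> complex set \<Rightarrow> bool" where
  "op_holomorphic_on F S \<longleftrightarrow>
     (\<forall>s\<in>S. \<exists>L. (F has_derivative (\<lambda>h. scaleC_blinfun h L)) (at s within S))"

text \<open>As for the scalar notion of the library, the values at isolated points are irrelevant.\<close>

definition op_meromorphic_on ::
    "(complex \<Rightarrow> 'a::complex_inner \<Rightarrow>\<^sub>L 'b::complex_inner) \<Rightarrow> complex set \<Rightarrow> bool" where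
  "op_meromorphic_on K S \<longleftrightarrow>
     (\<forall>p\<in>S. \<exists>r>0. \<exists>n::nat. \<exists>F. op_holomorphic_on F (ball p r) \<and>
        (\<forall>s\<in>ball p r - {p}. scaleC_blinfun ((s - p) ^ n) (K s) = F s))"

definition op_remove_sings ::
    "(complex \<Rightarrow> 'a::complex_inner \<Rightarrow>\<^sub>L 'b::complex_inner) \<Rightarrow> complex \<Rightarrow> 'a \<Rightarrow>\<^sub>L 'b" where
  "op_remove_sings G s = (if \<exists>L. G \<midarrow>s\<rightarrow> L then Lim (at s) G else 0)"

definition hinf_space :: "(complex \<Rightarrow> 'a::complex_inner \<Rightarrow>\<^sub>L 'b::complex_inner) set" where
  "hinf_space = {G. (\<forall>s\<in>right_half_plane. G s \<in> cblinfun) \<and>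
     op_holomorphic_on G right_half_plane \<and> bdd_above ((\<lambda>s. norm (G s)) ` right_half_plane)}"

definition hinf_norm :: "(complex \<Rightarrow> 'a::complex_inner \<Rightarrow>\<^sub>L 'b::complex_inner) \<Rightarrow> real" where
  "hinf_norm G = (SUP s\<in>right_half_plane. norm (G s))"

definition stable_tf :: "(complex \<Rightarrow> 'a::complex_inner \<Rightarrow>\<^sub>L 'b::complex_inner) \<Rightarrow> bool" where
  "stable_tf G \<longleftrightarrow> op_remove_sings G \<in> hinf_space"

definition tf_norm :: "(complex \<Rightarrow> 'a::complex_inner \<Rightarrow>\<^sub>L 'b::complex_inner) \<Rightarrow> real" where
  "tf_norm G = hinf_norm (op_remove_sings G)"

section \<open>The closed loop\<close>

definition loop_op ::
    "('z::complex_inner \<Rightarrow> 'z) \<Rightarrow> ('u::complex_inner \<Rightarrow>\<^sub>L 'z) \<Rightarrow> (complex \<Rightarrow> 'z \<Rightarrow>\<^sub>L 'u) \<Rightarrow>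
     complex \<Rightarrow> 'z \<Rightarrow> 'z" where
  "loop_op A B K s z = s *\<^sub>C z - A z - blinfun_apply B (blinfun_apply (K s) z)"

definition controllers ::
    "'z::complex_inner set \<Rightarrow> ('z \<Rightarrow> 'z) \<Rightarrow> ('u::complex_inner \<Rightarrow>\<^sub>L 'z) \<Rightarrow>
     (complex \<Rightarrow> 'z \<Rightarrow>\<^sub>L 'u) set" where
  "controllers D A B = {K.
     (\<forall>s\<in>right_half_plane. K s \<in> cblinfun) \<and>
     op_meromorphic_on K right_half_plane \<and>
     (\<forall>\<^sub>\<approx>s\<in>right_half_plane. has_bounded_inverse D (loop_op A B K s))}"

definition closed_loop ::
    "'z::complex_inner set \<Rightarrow> ('z \<Rightarrow> 'z) \<Rightarrow> ('u::complex_inner \<Rightarrow>\<^sub>L 'z) \<Rightarrow> ('d::complex_inner \<Rightarrow>\<^sub>L 'z) \<Rightarrow>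
     ('u \<Rightarrow>\<^sub>L 'r::complex_inner) \<Rightarrow> (complex \<Rightarrow> 'z \<Rightarrow>\<^sub>L 'u) \<Rightarrow> complex \<Rightarrow> 'd \<Rightarrow>\<^sub>L ('z \<times> 'r)" where
  "closed_loop D A B H R K s =
     blinfun_column id_blinfun (R o\<^sub>L K s) o\<^sub>L op_inverse D (loop_op A B K s) o\<^sub>L H"

definition stabilizing_controllers ::
    "'z::complex_inner set \<Rightarrow> ('z \<Rightarrow> 'z) \<Rightarrow> ('u::complex_inner \<Rightarrow>\<^sub>L 'z) \<Rightarrow> ('d::complex_inner \<Rightarrow>\<^sub>L 'z) \<Rightarrow>
     ('u \<Rightarrow>\<^sub>L 'r::complex_inner) \<Rightarrow> (complex \<Rightarrow> 'z \<Rightarrow>\<^sub>L 'u) set" where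
  "stabilizing_controllers D A B H R = {K \<in> controllers D A B. stable_tf (closed_loop D A B H R K)}"

definition inverse_gram :: "('u::complex_inner \<Rightarrow>\<^sub>L 'r::complex_inner) \<Rightarrow> 'u \<Rightarrow>\<^sub>L 'u" where
  "inverse_gram R = op_inverse UNIV (blinfun_apply (cadjoint R o\<^sub>L R))"

end

theory Submission
  imports Defs
begin

text \<open>
  Put \<open>S = B (R\<^sup>* R)\<^sup>-\<^sup>1 B\<^sup>*\<close> and \<open>M = A\<^sup>2 + S\<close>. The candidate for the optimal attenuation is the cost of a
  static problem: among all \<open>(z, u)\<close> with \<open>- A z - B u = h\<close>, which is the state equation at \<open>s = 0\<close>, the
  least value of \<open>\<parallel>z\<parallel>\<^sup>2 + \<parallel>R u\<parallel>\<^sup>2\<close> is \<open>\<langle>M\<^sup>-\<^sup>1 h, h\<rangle>\<close>. It is attained at \<open>z = - A p\<close>,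
  \<open>u = - (R\<^sup>* R)\<^sup>-\<^sup>1 B\<^sup>* p\<close> with \<open>p = M\<^sup>-\<^sup>1 h\<close>, and there \<open>u = K z\<close> for \<open>K = (R\<^sup>* R)\<^sup>-\<^sup>1 B\<^sup>* A\<^sup>-\<^sup>1\<close>.

  No controller does better: pairing an output \<open>(z, R u)\<close> at frequency \<open>s\<close> with the static optimum
  gives \<open>\<langle>h - s z, p\<rangle>\<close>, so by Cauchy-Schwarz a closed loop bounded by \<open>g\<close> satisfies
  \<open>\<langle>M\<^sup>-\<^sup>1 H d, H d\<rangle> \<le> g\<^sup>2 \<parallel>d\<parallel>\<^sup>2\<close> when \<open>s\<close> tends to \<open>0\<close> (\<open>output_ge\<close>, \<open>stabilizing_tf_norm_ge\<close>). The points
  \<open>s\<close> have to avoid the isolated set at which the loop or its controller is singular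
  (\<open>closed_loop_regular_cosparse\<close>).

  The static feedback \<open>K\<close> respects this bound at every frequency. For \<open>z = - A p\<close> the closed loop reads
  \<open>(M - s A) p = h\<close>, its squared output norm is \<open>\<langle>M p, p\<rangle>\<close>, and expanding \<open>\<langle>M\<^sup>-\<^sup>1 h, h\<rangle>\<close> shows that
  \<open>\<langle>M p, p\<rangle> \<le> \<langle>M\<^sup>-\<^sup>1 h, h\<rangle>\<close> for \<open>Re s \<ge> 0\<close>, because \<open>- A\<close> and \<open>M\<^sup>-\<^sup>1\<close> are positive (\<open>Ko_output_le\<close>).

  Both inverses that occur come from one bounded operator,
  \<open>C(s) = I - s A\<^sup>-\<^sup>1 + A\<^sup>-\<^sup>1 S A\<^sup>-\<^sup>1\<close>, whose real part is at least \<open>I\<close> for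
  \<open>Re s \<ge> 0\<close>: the loop operator of \<open>K\<close> is \<open>- A C(s)\<close>
  and \<open>M = A C(0) A\<close>. The surjectivity of \<open>A\<close> and \<open>C(s)\<close> and the existence of adjoints all follow
  from one Riesz-type lemma, \<open>riesz_relative\<close>.
\<close>

section \<open>Complex inner products\<close>

lemma cinner_add_right: "cinner x (y + z) = cinner x y + cinner x z"
  by (metis cinner_add_left cinner_commute complex_cnj_add)

lemma cinner_scaleC_right: "cinner x (c *\<^sub>C y) = cnj c * cinner x y"
  by (metis cinner_commute cinner_scaleC_left complex_cnj_mult)

lemma scaleC_zero_left [simp]: "0 *\<^sub>C x = 0"
  using scaleC_of_real[of 0 x] by simp

lemma scaleC_zero_right [simp]: "c *\<^sub>C 0 = 0"
  using scaleC_add_right[of c 0 0] by simp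

lemma scaleC_one [simp]: "1 *\<^sub>C x = x"
  using scaleC_of_real[of 1 x] by simp

lemma scaleC_minus_one: "(-1) *\<^sub>C x = - x"
  using scaleC_of_real[of "-1" x] by simp

lemma scaleC_minus_right [simp]: "c *\<^sub>C (- x) = - (c *\<^sub>C x)"
  using scaleC_add_right[of c x "-x"] by (simp add: eq_neg_iff_add_eq_0 add.commute)

lemma scaleC_minus_left [simp]: "(- c) *\<^sub>C x = - (c *\<^sub>C x)"
  using scaleC_add_left[of c "-c" x] by (simp add: eq_neg_iff_add_eq_0 add.commute)

lemma scaleC_diff_right: "c *\<^sub>C (x - y) = c *\<^sub>C x - c *\<^sub>C y"
  using scaleC_add_right[of c x "-y"] by simp

lemma scaleC_diff_left: "(c - d) *\<^sub>C x = c *\<^sub>C x - d *\<^sub>C x"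
  using scaleC_add_left[of c "-d" x] by simp

lemma scaleC_scaleR: "c *\<^sub>C (r *\<^sub>R x) = r *\<^sub>R (c *\<^sub>C x)"
  by (simp flip: scaleC_of_real add: scaleC_scaleC mult.commute)

lemma cinner_minus_right: "cinner x (- y) = - cinner x y"
  using cinner_scaleC_right[of x "-1" y] by (simp add: scaleC_minus_one)

lemma cinner_diff_right: "cinner x (y - z) = cinner x y - cinner x z"
  using cinner_add_right[of x y "-z"] by (simp add: cinner_minus_right)

lemma cinner_self_of_real: "cinner x x = of_real (inner x x)"
proof -
  have "Im (cinner x x) = - Im (cinner x x)"
    using arg_cong[OF cinner_commute[of x x], of Im] by simp
  then show ?thesis
    by (simp add: complex_eq_iff Re_cinner)
qed

lemma norm_scaleC: "norm (c *\<^sub>C x) = cmod c * norm x"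
proof -
  have "inner (c *\<^sub>C x) (c *\<^sub>C x) = Re (c * cnj c * of_real (inner x x))"
    by (metis Re_cinner cinner_scaleC_left cinner_scaleC_right cinner_self_of_real mult.assoc)
  also have "\<dots> = (cmod c)\<^sup>2 * (norm x)\<^sup>2"
    by (simp only: complex_norm_square[symmetric] of_real_mult[symmetric] Re_complex_of_real
        power2_norm_eq_inner)
  finally have "(norm (c *\<^sub>C x))\<^sup>2 = (cmod c * norm x)\<^sup>2"
    by (simp add: power2_norm_eq_inner power_mult_distrib)
  then show ?thesis
    by simp
qed

lemma cinner_eq_if_inner_eq:
  assumes "\<And>c. inner (c *\<^sub>C x) y = inner (c *\<^sub>C v) w"
  shows "cinner x y = cinner v w"
proof -
  have "Re (cinner x y) = Re (cinner v w)"
    using assms[of 1] by (simp add: Re_cinner)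
  moreover have "Re (\<i> * cinner x y) = Re (\<i> * cinner v w)"
    using assms[of \<i>] by (simp only: Re_cinner[symmetric] cinner_scaleC_left)
  ultimately show ?thesis
    by (simp add: complex_eq_iff)
qed

lemma bounded_linear_scaleC: "bounded_linear (\<lambda>x. c *\<^sub>C x)"
  by (rule bounded_linear_intro[where K = "cmod c"])
    (simp_all add: scaleC_add_right scaleC_scaleR norm_scaleC mult.commute)

lemma scaleC_blinfun_apply [simp]:
  "blinfun_apply (scaleC_blinfun c T) x = c *\<^sub>C blinfun_apply T x"
  unfolding scaleC_blinfun_def
  by (subst bounded_linear_Blinfun_apply)
    (auto intro: bounded_linear_compose[OF bounded_linear_scaleC] blinfun.bounded_linear_right)

lemma norm_scaleC_blinfun: "norm (scaleC_blinfun c T) = cmod c * norm T"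
proof (rule antisym)
  have le: "norm (scaleC_blinfun c T) \<le> cmod c * norm T" for c and T :: "'a \<Rightarrow>\<^sub>L 'b"
    by (rule norm_blinfun_bound) (simp_all add: norm_scaleC mult.assoc mult_left_mono norm_blinfun)
  show "norm (scaleC_blinfun c T) \<le> cmod c * norm T"
    by (rule le)
  show "cmod c * norm T \<le> norm (scaleC_blinfun c T)"
  proof (cases "c = 0")
    case False
    have "scaleC_blinfun (inverse c) (scaleC_blinfun c T) = T"
      by (rule blinfun_eqI) (simp add: scaleC_scaleC False)
    then show ?thesis
      using le[of "inverse c" "scaleC_blinfun c T"] False by (simp add: norm_divide inverse_eq_divide pos_le_divide_eq mult.commute)
  qed simp
qed

lemma bounded_bilinear_scaleC_blinfun: "bounded_bilinear scaleC_blinfun"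
proof
  show "\<exists>K. \<forall>c (T :: 'a \<Rightarrow>\<^sub>L 'b). norm (scaleC_blinfun c T) \<le> norm c * norm T * K"
    by (intro exI[of _ 1]) (simp add: norm_scaleC_blinfun)
next
  fix r c and T :: "'a \<Rightarrow>\<^sub>L 'b"
  show "scaleC_blinfun (r *\<^sub>R c) T = r *\<^sub>R scaleC_blinfun c T"
    by (rule blinfun_eqI)
      (simp add: blinfun.scaleR_left scaleR_conv_of_real scaleC_scaleC[symmetric] scaleC_of_real)
  show "scaleC_blinfun c (r *\<^sub>R T) = r *\<^sub>R scaleC_blinfun c T"
    by (rule blinfun_eqI) (simp add: blinfun.scaleR_left scaleC_scaleR)
qed (rule blinfun_eqI, simp add: blinfun.add_left scaleC_add_left scaleC_add_right)+

lemma scaleC_blinfun_one [simp]: "scaleC_blinfun 1 T = T"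
  by (rule blinfun_eqI) simp

lemma cblinfunI: "(\<And>c x. blinfun_apply T (c *\<^sub>C x) = c *\<^sub>C blinfun_apply T x) \<Longrightarrow> T \<in> cblinfun"
  by (simp add: cblinfun_def)

lemma cblinfunD: "T \<in> cblinfun \<Longrightarrow> blinfun_apply T (c *\<^sub>C x) = c *\<^sub>C blinfun_apply T x"
  by (simp add: cblinfun_def)

lemma cblinfun_compose: "S \<in> cblinfun \<Longrightarrow> T \<in> cblinfun \<Longrightarrow> S o\<^sub>L T \<in> cblinfun"
  by (simp add: cblinfun_def)

lemma blinfun_compose_assoc: "S o\<^sub>L T o\<^sub>L U = S o\<^sub>L (T o\<^sub>L U)"
  by (rule blinfun_eqI) simp

lemma blinfun_column_apply [simp]:
  "blinfun_apply (blinfun_column S T) x = (blinfun_apply S x, blinfun_apply T x)"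
  unfolding blinfun_column_def
  by (subst bounded_linear_Blinfun_apply)
    (auto intro: bounded_linear_Pair blinfun.bounded_linear_right)

lemma norm_Pair_sq: "(norm (x, y))\<^sup>2 = (norm x)\<^sup>2 + (norm y)\<^sup>2"
  by (simp add: norm_prod_def)

text \<open>For fixed \<open>S\<close> the column operator is affine, not linear, in its second entry.\<close>

lemma bounded_linear_blinfun_column: "bounded_linear (\<lambda>T. blinfun_column S T - blinfun_column S 0)"
proof (rule bounded_linear_intro[where K = 1])
  fix T show "norm (blinfun_column S T - blinfun_column S 0) \<le> norm T * 1"
    by (rule norm_blinfun_bound) (simp_all add: blinfun.bilinear_simps norm_blinfun)
qed (rule blinfun_eqI, simp add: blinfun.bilinear_simps)+

lemma tendsto_blinfun_column:
  assumes "(f \<longlongrightarrow> T) F"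
  shows "((\<lambda>x. blinfun_column S (f x)) \<longlongrightarrow> blinfun_column S T) F"
  using tendsto_add[OF bounded_linear.tendsto[OF bounded_linear_blinfun_column[of S] assms]
      tendsto_const[of "blinfun_column S 0"]] by simp

section \<open>Representation of functionals, adjoints and inverses\<close>

text \<open>
  A Riesz representation relative to an operator: the minimising sequences of
  \<open>\<parallel>N x\<parallel>\<^sup>2 - 2 * g x\<close> are mapped by \<open>N\<close> to Cauchy sequences, and their limit represents \<open>g\<close>.
  With \<open>N\<close> the identity this is the Riesz theorem; with \<open>N\<close> the adjoint of an operator, and
  bounded below, it yields the surjectivity of that operator.
\<close>

lemma riesz_relative:
  fixes N :: "'a::real_vector \<Rightarrow> 'b::{real_inner, complete_space}"
  assumes D: "subspace D"
    and N: "\<And>x y. x \<in> D \<Longrightarrow> y \<in> D \<Longrightarrow> N (x + y) = N x + N y"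
      "\<And>r x. x \<in> D \<Longrightarrow> N (r *\<^sub>R x) = r *\<^sub>R N x"
    and g: "\<And>x y. x \<in> D \<Longrightarrow> y \<in> D \<Longrightarrow> g (x + y) = g x + g y"
      "\<And>r x. x \<in> D \<Longrightarrow> g (r *\<^sub>R x) = r * g x"
    and bnd: "\<And>x. x \<in> D \<Longrightarrow> \<bar>g x\<bar> \<le> c * norm (N x)"
  shows "\<exists>q. \<forall>x\<in>D. g x = inner (N x) q"
proof -
  define J where "J x = (norm (N x))\<^sup>2 - 2 * g x" for x
  define m where "m = (INF x\<in>D. J x)"
  have ne: "D \<noteq> {}"
    using D subspace_0 by blast
  have "- (c\<^sup>2) \<le> J x" if "x \<in> D" for x
  proof -
    have "0 \<le> (norm (N x) - c)\<^sup>2" by simp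
    then show ?thesis
      using bnd[OF that] unfolding J_def power2_diff by (simp add: algebra_simps)
  qed
  then have bdd: "bdd_below (J ` D)"
    by (rule bdd_belowI2)
  have mJ: "m \<le> J x" if "x \<in> D" for x
    unfolding m_def using bdd that by (rule cINF_lower)
  have "\<exists>x\<in>D. J x < m + 1 / real (Suc n)" for n
  proof -
    have "(INF x\<in>D. J x) < m + 1 / real (Suc n)"
      unfolding m_def by simp
    then show ?thesis
      using cINF_less_iff[OF ne bdd] by blast
  qed
  then obtain X where X: "\<And>n. X n \<in> D" and XJ: "\<And>n. J (X n) < m + 1 / real (Suc n)"
    by metis
  \<comment> \<open>The parallelogram law, applied to the midpoint of \<open>x\<close> and \<open>y\<close>.\<close>
  have par: "(norm (N x - N y))\<^sup>2 \<le> 2 * (J x - m) + 2 * (J y - m)" if xy: "x \<in> D" "y \<in> D" for x y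
  proof -
    have xyD: "x + y \<in> D"
      using D xy by (rule subspace_add)
    then have hD: "(1/2) *\<^sub>R (x + y) \<in> D"
      using D by (simp add: subspace_scale)
    have "N ((1/2) *\<^sub>R (x + y)) = (1/2) *\<^sub>R (N x + N y)" "g ((1/2) *\<^sub>R (x + y)) = (g x + g y) / 2"
      using N(2)[OF xyD, of "1/2"] g(2)[OF xyD, of "1/2"] N(1)[OF xy] g(1)[OF xy] by simp_all
    then have "J ((1/2) *\<^sub>R (x + y)) = (norm (N x + N y))\<^sup>2 / 4 - (g x + g y)"
      unfolding J_def by (simp add: power_divide del: scaleR_add_right)
    moreover have "(norm (N x + N y))\<^sup>2 + (norm (N x - N y))\<^sup>2 = 2 * (norm (N x))\<^sup>2 + 2 * (norm (N y))\<^sup>2"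
      by (simp add: power2_norm_eq_inner inner_add_left inner_add_right inner_diff_left
          inner_diff_right inner_commute)
    ultimately show ?thesis
      using mJ[OF hD] J_def[of x] J_def[of y] by argo
  qed
  have "Cauchy (\<lambda>n. N (X n))"
  proof (rule metric_CauchyI)
    fix e :: real assume e: "0 < e"
    obtain n0 where n0: "4 / e\<^sup>2 < real n0"
      using reals_Archimedean2 by blast
    have small: "J (X n) - m < e\<^sup>2 / 4" if "n \<ge> n0" for n
    proof -
      have "4 / e\<^sup>2 < real (Suc n)"
        using n0 that by linarith
      then have "1 / real (Suc n) < e\<^sup>2 / 4"
        using e by (simp add: field_simps)
      then show ?thesis
        using XJ[of n] by linarith
    qed
    have "dist (N (X k)) (N (X n)) < e" if "k \<ge> n0" "n \<ge> n0" for k n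
    proof -
      have "(norm (N (X k) - N (X n)))\<^sup>2 < e\<^sup>2"
        using par[OF X X, of k n] small[OF that(1)] small[OF that(2)] by argo
      then show ?thesis
        using e by (simp add: dist_norm power_less_imp_less_base)
    qed
    then show "\<exists>M. \<forall>m\<ge>M. \<forall>n\<ge>M. dist (N (X m)) (N (X n)) < e"
      by blast
  qed
  then obtain q where q: "(\<lambda>n. N (X n)) \<longlonglongrightarrow> q"
    using Cauchy_convergent_iff convergent_def by blast
  have "g x = inner (N x) q" if x: "x \<in> D" for x
  proof -
    \<comment> \<open>First variation of \<open>J\<close> in the direction \<open>x\<close>, along the minimising sequence.\<close>
    have var: "0 \<le> 2 * t * (inner (N x) q - g x) + t\<^sup>2 * (norm (N x))\<^sup>2" for t
    proof (rule LIMSEQ_le_const)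
      have "(\<lambda>n. 1 / real (Suc n)) \<longlonglongrightarrow> 0"
        using LIMSEQ_inverse_real_of_nat by (simp add: inverse_eq_divide)
      moreover have "(\<lambda>n. 2 * t * (inner (N x) (N (X n)) - g x) + t\<^sup>2 * (norm (N x))\<^sup>2)
          \<longlonglongrightarrow> 2 * t * (inner (N x) q - g x) + t\<^sup>2 * (norm (N x))\<^sup>2"
        by (intro tendsto_intros q)
      ultimately have "(\<lambda>n. 1 / real (Suc n) + (2 * t * (inner (N x) (N (X n)) - g x) + t\<^sup>2 * (norm (N x))\<^sup>2))
          \<longlonglongrightarrow> 0 + (2 * t * (inner (N x) q - g x) + t\<^sup>2 * (norm (N x))\<^sup>2)"
        by (rule tendsto_add)
      then show "(\<lambda>n. 1 / real (Suc n) + (2 * t * (inner (N x) (N (X n)) - g x) + t\<^sup>2 * (norm (N x))\<^sup>2))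
          \<longlonglongrightarrow> 2 * t * (inner (N x) q - g x) + t\<^sup>2 * (norm (N x))\<^sup>2"
        by simp
      have "0 \<le> 1 / real (Suc n) + (2 * t * (inner (N x) (N (X n)) - g x) + t\<^sup>2 * (norm (N x))\<^sup>2)" for n
      proof -
        have tx: "t *\<^sub>R x \<in> D"
          using D x by (simp add: subspace_scale)
        have "J (X n + t *\<^sub>R x) = J (X n) + (2 * t * (inner (N x) (N (X n)) - g x) + t\<^sup>2 * (norm (N x))\<^sup>2)"
          unfolding J_def using x X[of n] tx
          by (simp add: N g power2_norm_eq_inner inner_add_left inner_add_right inner_commute
              algebra_simps power2_eq_square[of t])
        moreover have "X n + t *\<^sub>R x \<in> D"
          using D X tx by (simp add: subspace_add)
        ultimately show ?thesis
          using mJ[of "X n + t *\<^sub>R x"] XJ[of n] by linarith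
      qed
      then show "\<exists>k. \<forall>n\<ge>k. 0 \<le> 1 / real (Suc n)
          + (2 * t * (inner (N x) (N (X n)) - g x) + t\<^sup>2 * (norm (N x))\<^sup>2)"
        by blast
    qed
    define a where "a = inner (N x) q - g x"
    define b where "b = (norm (N x))\<^sup>2 + 1"
    have b: "b > 0"
      unfolding b_def by (simp add: add_nonneg_pos)
    have "0 \<le> 2 * (- a / b) * a + (- a / b)\<^sup>2 * b"
      using var[of "- a / b"] unfolding a_def b_def
      by (smt (verit) mult_left_mono zero_le_power2)
    also have "\<dots> = - (a\<^sup>2 / b)"
      using b by (simp add: power2_eq_square field_simps)
    finally have "a\<^sup>2 / b \<le> 0"
      by simp
    then have "a = 0"
      using b by (simp add: divide_le_0_iff)
    then show ?thesis
      unfolding a_def by simp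
  qed
  then show ?thesis
    by blast
qed

lemma has_bounded_inverseI:
  fixes W :: "'b::complex_inner \<Rightarrow>\<^sub>L 'a::complex_inner"
  assumes "\<And>x. x \<in> D \<Longrightarrow> blinfun_apply W (T x) = x"
    and "\<And>y. blinfun_apply W y \<in> D" and "\<And>y. T (blinfun_apply W y) = y"
  shows "has_bounded_inverse D T" and "op_inverse D T = W"
proof -
  have bij: "bij_betw T D UNIV"
    by (rule bij_betw_byWitness[where f' = "blinfun_apply W"]) (use assms in auto)
  have "inv_into D T y = blinfun_apply W y" for y
    using bij assms(2)[of y] assms(3)[of y] by (metis bij_betw_imp_inj_on inv_into_f_f)
  then have eq: "inv_into D T = blinfun_apply W"
    by blast
  show "has_bounded_inverse D T"
    unfolding has_bounded_inverse_def eq using bij by (simp add: blinfun.bounded_linear_right)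
  show "op_inverse D T = W"
    unfolding op_inverse_def eq by (rule blinfun_apply_inverse)
qed

lemma
  assumes "has_bounded_inverse D T"
  shows op_inverse_in: "blinfun_apply (op_inverse D T) y \<in> D"
    and op_inverse_right: "T (blinfun_apply (op_inverse D T) y) = y"
    and op_inverse_left: "x \<in> D \<Longrightarrow> blinfun_apply (op_inverse D T) (T x) = x"
proof -
  have bij: "bij_betw T D UNIV" and "bounded_linear (inv_into D T)"
    using assms by (auto simp: has_bounded_inverse_def)
  then have ap: "blinfun_apply (op_inverse D T) = inv_into D T"
    unfolding op_inverse_def by (simp add: bounded_linear_Blinfun_apply)
  have y: "y \<in> T ` D" for y
    using bij by (simp add: bij_betw_def)
  show "blinfun_apply (op_inverse D T) y \<in> D" "T (blinfun_apply (op_inverse D T) y) = y"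
    unfolding ap using y by (auto intro: inv_into_into f_inv_into_f)
  show "x \<in> D \<Longrightarrow> blinfun_apply (op_inverse D T) (T x) = x"
    unfolding ap using bij by (simp add: bij_betw_def)
qed

lemma op_inverse_cblinfun:
  assumes inv: "has_bounded_inverse D T"
    and D: "\<And>c x. x \<in> D \<Longrightarrow> c *\<^sub>C x \<in> D" and T: "\<And>c x. x \<in> D \<Longrightarrow> T (c *\<^sub>C x) = c *\<^sub>C T x"
  shows "op_inverse D T \<in> cblinfun"
proof (rule cblinfunI)
  fix c y
  let ?W = "blinfun_apply (op_inverse D T)"
  have "?W (c *\<^sub>C y) = ?W (T (c *\<^sub>C ?W y))"
    using op_inverse_in[OF inv] by (simp add: T op_inverse_right[OF inv])
  also have "\<dots> = c *\<^sub>C ?W y"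
    by (intro op_inverse_left[OF inv] D op_inverse_in[OF inv])
  finally show "?W (c *\<^sub>C y) = c *\<^sub>C ?W y" .
qed

lemma bounded_below_surj_imp_inverse:
  fixes T :: "'a::complex_inner \<Rightarrow> 'b::complex_inner"
  assumes D: "subspace D"
    and T: "\<And>x y. x \<in> D \<Longrightarrow> y \<in> D \<Longrightarrow> T (x + y) = T x + T y"
      "\<And>r x. x \<in> D \<Longrightarrow> T (r *\<^sub>R x) = r *\<^sub>R T x"
    and c: "c > 0" and below: "\<And>x. x \<in> D \<Longrightarrow> c * norm x \<le> norm (T x)"
    and surj: "\<And>y. \<exists>x\<in>D. T x = y"
  shows "has_bounded_inverse D T" and "norm (op_inverse D T) \<le> 1 / c"
proof -
  have T_inj: "x = y" if "x \<in> D" "y \<in> D" "T x = T y" for x y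
  proof -
    have my: "- y \<in> D" "T (- y) = - T y"
      using T(2)[OF that(2), of "-1"] subspace_neg[OF D that(2)] by auto
    have "T (x + - y) = 0" and d: "x + - y \<in> D"
      using T(1)[OF that(1) my(1)] my that subspace_add[OF D that(1) my(1)] by auto
    then have "c * norm (x - y) \<le> 0"
      using below[OF d] by simp
    then show ?thesis
      using c by (simp add: mult_le_0_iff)
  qed
  obtain W where WD: "\<And>y. W y \<in> D" and TW: "\<And>y. T (W y) = y"
    using surj by metis
  have Wb: "norm (W y) \<le> norm y * (1 / c)" for y
    using below[OF WD, of y] c by (simp add: TW field_simps)
  have bl: "bounded_linear W"
  proof (rule bounded_linear_intro[where K = "1 / c"])
    fix x y r
    show "W (x + y) = W x + W y"
      by (intro T_inj WD subspace_add D) (simp add: T TW WD)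
    show "W (r *\<^sub>R x) = r *\<^sub>R W x"
      by (intro T_inj WD subspace_scale D) (simp add: T TW WD)
  qed (rule Wb)
  note ap = bounded_linear_Blinfun_apply[OF bl]
  have "has_bounded_inverse D T \<and> op_inverse D T = Blinfun W"
    using has_bounded_inverseI[of D "Blinfun W" T] WD TW T_inj by (metis ap)
  then show "has_bounded_inverse D T" and "norm (op_inverse D T) \<le> 1 / c"
    using norm_blinfun_bound[of "1 / c" "Blinfun W"] Wb c by (auto simp: ap mult.commute)
qed

text \<open>The lower bound for the adjoint \<open>T'\<close> makes \<open>T\<close> surjective.\<close>

lemma bounded_adjoint_pair_inverse:
  fixes T T' :: "'a::{complex_inner, complete_space} \<Rightarrow>\<^sub>L 'a"
  assumes adj: "\<And>x y. inner (blinfun_apply T' x) y = inner x (blinfun_apply T y)"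
    and c: "c > 0" and below: "\<And>x. c * norm x \<le> norm (blinfun_apply T x)"
      "\<And>x. c * norm x \<le> norm (blinfun_apply T' x)"
  shows "has_bounded_inverse UNIV (blinfun_apply T)"
    and "norm (op_inverse UNIV (blinfun_apply T)) \<le> 1 / c"
proof -
  have surj: "\<exists>x\<in>UNIV. blinfun_apply T x = y" for y
  proof -
    have "\<bar>inner x y\<bar> \<le> norm y / c * norm (blinfun_apply T' x)" for x
    proof -
      have "\<bar>inner x y\<bar> \<le> norm x * norm y"
        by (rule Cauchy_Schwarz_ineq2)
      also have "\<dots> \<le> (norm (blinfun_apply T' x) / c) * norm y"
        using below(2)[of x] c by (intro mult_right_mono) (simp_all add: field_simps)
      finally show ?thesis by (simp add: mult.commute)
    qed
    then obtain q where "\<And>x. inner x y = inner (blinfun_apply T' x) q"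
      using riesz_relative[of UNIV "blinfun_apply T'" "\<lambda>x. inner x y" "norm y / c"]
      by (auto simp: blinfun.bilinear_simps inner_add_left)
    then have "inner x (blinfun_apply T q - y) = 0" for x
      by (simp add: adj inner_diff_right)
    then show ?thesis
      by (metis inner_eq_zero_iff right_minus_eq UNIV_I)
  qed
  note * = bounded_below_surj_imp_inverse[of UNIV "blinfun_apply T", OF _ _ _ c _ surj]
  show "has_bounded_inverse UNIV (blinfun_apply T)"
    by (rule *) (auto simp: blinfun.bilinear_simps below)
  show "norm (op_inverse UNIV (blinfun_apply T)) \<le> 1 / c"
    by (rule *) (auto simp: blinfun.bilinear_simps below)
qed

lemma cadjoint_exists:
  fixes T :: "'a::{complex_inner, complete_space} \<Rightarrow>\<^sub>L 'b::complex_inner"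
  assumes T: "T \<in> cblinfun"
  shows "\<exists>S. \<forall>x y. cinner (blinfun_apply T x) y = cinner x (blinfun_apply S y)"
proof -
  have "\<exists>q. \<forall>x\<in>UNIV. inner (blinfun_apply T x) y = inner x q" for y
  proof (rule riesz_relative[of UNIV "\<lambda>x. x", where c = "norm T * norm y"])
    fix x
    have "\<bar>inner (blinfun_apply T x) y\<bar> \<le> norm (blinfun_apply T x) * norm y"
      by (rule Cauchy_Schwarz_ineq2)
    also have "\<dots> \<le> norm T * norm x * norm y"
      by (intro mult_right_mono norm_blinfun) simp
    finally show "\<bar>inner (blinfun_apply T x) y\<bar> \<le> norm T * norm y * norm x"
      by (simp add: mult_ac)
  qed (auto simp: blinfun.bilinear_simps inner_add_left)
  then obtain S where S: "\<And>x y. inner (blinfun_apply T x) y = inner x (S y)"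
    by (metis UNIV_I)
  have eqI: "v = w" if "\<And>x. inner x v = inner x w" for v w :: 'a
    using that[of "v - w"] by (metis inner_diff_right inner_eq_zero_iff right_minus_eq)
  have "bounded_linear S"
  proof (rule bounded_linear_intro[where K = "norm T"])
    fix x y r
    show "S (x + y) = S x + S y" by (rule eqI) (simp flip: S add: inner_add_right)
    show "S (r *\<^sub>R x) = r *\<^sub>R S x" by (rule eqI) (simp flip: S)
    have "norm (S x) * norm (S x) = inner (blinfun_apply T (S x)) x"
      by (simp add: S flip: power2_norm_eq_inner power2_eq_square)
    also have "\<dots> \<le> norm (blinfun_apply T (S x)) * norm x"
      by (rule norm_cauchy_schwarz)
    also have "\<dots> \<le> norm T * norm (S x) * norm x"
      by (intro mult_right_mono norm_blinfun) simp
    finally have "norm (S x) * norm (S x) \<le> norm (S x) * (norm x * norm T)"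
      by (simp add: mult_ac)
    then show "norm (S x) \<le> norm x * norm T"
      by (cases "S x = 0") simp_all
  qed
  note ap = bounded_linear_Blinfun_apply[OF this]
  show ?thesis
    by (intro exI[of _ "Blinfun S"] allI cinner_eq_if_inner_eq)
      (simp add: ap flip: S cblinfunD[OF T])
qed

lemma cinner_cadjoint:
  fixes T :: "'a::{complex_inner, complete_space} \<Rightarrow>\<^sub>L 'b::complex_inner"
  assumes "T \<in> cblinfun"
  shows "cinner (blinfun_apply T x) y = cinner x (blinfun_apply (cadjoint T) y)"
proof -
  let ?P = "\<lambda>S. \<forall>x y. cinner (blinfun_apply T x) y = cinner x (blinfun_apply S y)"
  have "\<exists>!S. ?P S"
  proof (rule ex_ex1I[OF cadjoint_exists[OF assms]])
    fix S S' assume "?P S" "?P S'"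
    then have "inner (blinfun_apply S y - blinfun_apply S' y) (blinfun_apply S y - blinfun_apply S' y) = 0" for y
      by (metis Re_cinner inner_diff_right right_minus_eq)
    then show "S = S'"
      by (intro blinfun_eqI) (simp add: inner_eq_zero_iff)
  qed
  from theI'[OF this] show ?thesis
    unfolding cadjoint_def by blast
qed

lemma inner_cadjoint:
  fixes T :: "'a::{complex_inner, complete_space} \<Rightarrow>\<^sub>L 'b::complex_inner"
  shows "T \<in> cblinfun \<Longrightarrow> inner (blinfun_apply T x) y = inner x (blinfun_apply (cadjoint T) y)"
  by (metis Re_cinner cinner_cadjoint)

lemma cadjoint_cblinfun:
  fixes T :: "'a::{complex_inner, complete_space} \<Rightarrow>\<^sub>L 'b::complex_inner"
  assumes T: "T \<in> cblinfun"
  shows "cadjoint T \<in> cblinfun"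
proof (rule cblinfunI)
  fix c y
  let ?d = "blinfun_apply (cadjoint T) (c *\<^sub>C y) - c *\<^sub>C blinfun_apply (cadjoint T) y"
  have "cinner x ?d = 0" for x
    by (simp add: cinner_diff_right cinner_scaleC_right flip: cinner_cadjoint[OF T])
  then have "inner ?d ?d = 0"
    by (metis Re_cinner zero_complex.sel(1))
  then show "blinfun_apply (cadjoint T) (c *\<^sub>C y) = c *\<^sub>C blinfun_apply (cadjoint T) y"
    by simp
qed

text \<open>By polarisation, the numerical bound of a symmetric positive operator is its norm.\<close>

lemma norm_symmetric_positive_le:
  fixes Q :: "'a::real_inner \<Rightarrow>\<^sub>L 'a"
  assumes sym: "\<And>x y. inner (blinfun_apply Q x) y = inner x (blinfun_apply Q y)"
    and pos: "\<And>x. 0 \<le> inner (blinfun_apply Q x) x"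
    and bnd: "\<And>x. inner (blinfun_apply Q x) x \<le> g * (norm x)\<^sup>2" and g: "0 \<le> g"
  shows "norm Q \<le> g"
proof (rule norm_blinfun_bound[OF g])
  fix x
  have *: "2 * inner (blinfun_apply Q x) y \<le> g * ((norm x)\<^sup>2 + (norm y)\<^sup>2)" for y
  proof -
    have "4 * inner (blinfun_apply Q x) y = inner (blinfun_apply Q (x + y)) (x + y)
        - inner (blinfun_apply Q (x - y)) (x - y)"
      using sym[of y x]
      by (simp add: blinfun.bilinear_simps inner_add_left inner_add_right inner_diff_left
          inner_diff_right inner_commute)
    also have "\<dots> \<le> g * (norm (x + y))\<^sup>2"
      using pos[of "x - y"] bnd[of "x + y"] by linarith
    also have "\<dots> \<le> g * ((norm (x + y))\<^sup>2 + (norm (x - y))\<^sup>2)"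
      using g by (simp add: mult_left_mono)
    also have "(norm (x + y))\<^sup>2 + (norm (x - y))\<^sup>2 = 2 * ((norm x)\<^sup>2 + (norm y)\<^sup>2)"
      by (simp add: power2_norm_eq_inner inner_add_left inner_add_right inner_diff_left
          inner_diff_right inner_commute)
    finally show ?thesis by (simp add: algebra_simps)
  qed
  let ?q = "norm (blinfun_apply Q x)"
  show "?q \<le> g * norm x"
  proof (cases "?q = 0")
    case False
    \<comment> \<open>The choice \<open>y = t *\<^sub>R Q x\<close> with \<open>\<parallel>y\<parallel> = \<parallel>x\<parallel>\<close>.\<close>
    have "2 * (norm x * ?q) \<le> g * (2 * (norm x)\<^sup>2)"
      using *[of "(norm x / ?q) *\<^sub>R blinfun_apply Q x"] False
      by (simp add: power2_norm_eq_inner[symmetric] power2_eq_square)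
    then have "norm x * ?q \<le> norm x * (g * norm x)"
      by (simp add: power2_eq_square mult_ac)
    moreover have "norm x > 0"
      using False by auto
    ultimately show ?thesis by simp
  qed (simp add: g)
qed

section \<open>Operator-valued functions\<close>

lemma op_remove_sings_eq: "G \<midarrow>s\<rightarrow> L \<Longrightarrow> op_remove_sings G s = L"
  unfolding op_remove_sings_def using tendsto_Lim[of "at s" G L] by auto

text \<open>
  Resolvent identity: the inverse depends continuously on a bounded perturbation. Invertibility of the
  perturbed operators is a hypothesis, as it is part of the definition of a controller.
\<close>

lemma tendsto_op_inverse:
  fixes T :: "'i \<Rightarrow> 'a::complex_inner \<Rightarrow> 'b::complex_inner"
  assumes inv0: "has_bounded_inverse D T0" and inv: "\<forall>\<^sub>F s in F. has_bounded_inverse D (T s)"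
    and E: "(E \<longlongrightarrow> 0) F" and T: "\<And>s z. z \<in> D \<Longrightarrow> T s z = T0 z + blinfun_apply (E s) z"
  shows "((\<lambda>s. op_inverse D (T s)) \<longlongrightarrow> op_inverse D T0) F"
proof -
  define V where "V s = op_inverse D (T s)" for s
  define V0 where "V0 = op_inverse D T0"
  define b where "b = norm V0"
  have b: "0 \<le> b" by (simp add: b_def)
  have Eb: "((\<lambda>s. norm (E s) * b) \<longlongrightarrow> 0) F"
    using tendsto_mult[OF tendsto_norm[OF E] tendsto_const[of b]] by simp
  then have small: "\<forall>\<^sub>F s in F. norm (E s) * b < 1 / 2"
    by (rule order_tendstoD) simp
  have "\<forall>\<^sub>F s in F. norm (V s - V0) \<le> 2 * b * (norm (E s) * b)"
    using inv small
  proof eventually_elim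
    case (elim s)
    have "V0 - V s = V s o\<^sub>L (E s o\<^sub>L V0)"
    proof (rule blinfun_eqI)
      fix y
      have "T s (blinfun_apply V0 y) = y + blinfun_apply (E s) (blinfun_apply V0 y)"
        unfolding V0_def by (simp add: T op_inverse_in[OF inv0] op_inverse_right[OF inv0])
      then have "blinfun_apply V0 y = blinfun_apply (V s) (y + blinfun_apply (E s) (blinfun_apply V0 y))"
        unfolding V_def using op_inverse_left[OF elim(1), of "blinfun_apply V0 y"]
        by (simp add: V0_def op_inverse_in[OF inv0])
      then show "blinfun_apply (V0 - V s) y = blinfun_apply (V s o\<^sub>L (E s o\<^sub>L V0)) y"
        by (simp add: blinfun.diff_left blinfun.add_right diff_eq_eq add.commute)
    qed
    then have "norm (V s - V0) \<le> norm (V s) * norm (E s o\<^sub>L V0)"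
      by (metis norm_blinfun_compose norm_minus_commute)
    also have "\<dots> \<le> norm (V s) * (norm (E s) * b)"
      unfolding b_def by (intro mult_left_mono norm_blinfun_compose) simp
    finally have d: "norm (V s - V0) \<le> norm (V s) * (norm (E s) * b)" .
    also have "\<dots> \<le> norm (V s) * (1 / 2)"
      using elim(2) by (intro mult_left_mono) auto
    finally have "norm (V s - V0) \<le> norm (V s) / 2"
      by simp
    moreover have "norm (V s) \<le> norm (V s - V0) + b"
      unfolding b_def by (metis add.commute diff_add_cancel norm_triangle_ineq)
    ultimately have "norm (V s) \<le> 2 * b"
      by linarith
    then show ?case
      using d b by (meson mult_right_mono mult_nonneg_nonneg norm_ge_zero order_trans)
  qed
  moreover have "((\<lambda>s. 2 * b * (norm (E s) * b)) \<longlongrightarrow> 0) F"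
    using tendsto_mult[OF tendsto_const[of "2 * b"] Eb] by simp
  ultimately have "((\<lambda>s. V s - V0) \<longlongrightarrow> 0) F"
    by (rule Lim_null_comparison)
  then show ?thesis
    unfolding V_def V0_def by (rule LIM_zero_cancel)
qed

lemma open_right_half_plane: "open right_half_plane"
  unfolding right_half_plane_def by (rule open_halfspace_Re_gt)

text \<open>
  Off an isolated set a meromorphic function is continuous, values included: near \<open>p\<close> it agrees with
  \<open>(s - p)\<^sup>-\<^sup>n F(s)\<close> at every point other than \<open>p\<close>.
\<close>

lemma op_meromorphic_on_continuous_cosparse:
  assumes K: "op_meromorphic_on K S" and S: "open S"
  shows "\<forall>\<^sub>\<approx>s\<in>S. K \<midarrow>s\<rightarrow> K s"
  unfolding eventually_cosparse_open_eq[OF S]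
proof
  fix p assume "p \<in> S"
  then obtain r n F where r: "r > 0" and F: "op_holomorphic_on F (ball p r)"
    and KF: "\<And>s. s \<in> ball p r - {p} \<Longrightarrow> scaleC_blinfun ((s - p) ^ n) (K s) = F s"
    using K unfolding op_meromorphic_on_def by metis
  define K' where "K' s = scaleC_blinfun (inverse ((s - p) ^ n)) (F s)" for s
  have KK': "K s = K' s" if "s \<in> ball p r - {p}" for s
    unfolding K'_def KF[OF that, symmetric]
    by (rule blinfun_eqI) (use that in \<open>simp add: scaleC_scaleC\<close>)
  have "K \<midarrow>s\<rightarrow> K s" if s: "s \<in> ball p r - {p}" for s
  proof -
    obtain L where "(F has_derivative (\<lambda>h. scaleC_blinfun h L)) (at s within ball p r)"
      using F s unfolding op_holomorphic_on_def by blast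
    then have "F \<midarrow>s\<rightarrow> F s"
      using has_derivative_continuous[of F _ s "ball p r"] s
      by (simp add: continuous_within at_within_open[OF _ open_ball])
    moreover have "(\<lambda>x. inverse ((x - p) ^ n)) \<midarrow>s\<rightarrow> inverse ((s - p) ^ n)"
      using s by (intro tendsto_intros) auto
    ultimately have "K' \<midarrow>s\<rightarrow> K' s"
      unfolding K'_def by (intro bounded_bilinear.tendsto[OF bounded_bilinear_scaleC_blinfun])
    moreover have "\<forall>\<^sub>F x in at s. K' x = K x"
      using eventually_at_in_open'[OF open_delete[OF open_ball] s]
      by eventually_elim (simp add: KK')
    ultimately show ?thesis
      using KK'[OF s] tendsto_cong[of K' K "at s"] by simp
  qed
  then show "\<forall>\<^sub>F s in at p. K \<midarrow>s\<rightarrow> K s"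
    using eventually_at_in_open[of "ball p r" p] r by (auto elim: eventually_mono)
qed

lemma closed_loop_continuous:
  assumes K: "K \<midarrow>s\<rightarrow> K s" and inv: "has_bounded_inverse D (loop_op A B K s)"
    and ev: "\<forall>\<^sub>F x in at s. has_bounded_inverse D (loop_op A B K x)"
  shows "closed_loop D A B H R K \<midarrow>s\<rightarrow> closed_loop D A B H R K s"
proof -
  define E where "E x = scaleC_blinfun (x - s) id_blinfun - (B o\<^sub>L (K x - K s))" for x
  have "(E \<longlongrightarrow> scaleC_blinfun (s - s) id_blinfun - (B o\<^sub>L (K s - K s))) (at s)"
    unfolding E_def
    by (intro tendsto_intros K bounded_bilinear.tendsto[OF bounded_bilinear_scaleC_blinfun]
        bounded_bilinear.tendsto[OF bounded_bilinear_blinfun_compose])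
  moreover have "scaleC_blinfun (s - s) id_blinfun - (B o\<^sub>L (K s - K s)) = 0"
    by (rule blinfun_eqI) (simp add: blinfun.bilinear_simps)
  ultimately have "(E \<longlongrightarrow> 0) (at s)"
    by simp
  moreover have "loop_op A B K x z = loop_op A B K s z + blinfun_apply (E x) z" for x z
    unfolding loop_op_def E_def by (simp add: blinfun.bilinear_simps scaleC_diff_left)
  ultimately have "((\<lambda>x. op_inverse D (loop_op A B K x)) \<longlongrightarrow> op_inverse D (loop_op A B K s)) (at s)"
    using inv ev by (intro tendsto_op_inverse)
  then show ?thesis
    unfolding closed_loop_def
    by (intro bounded_bilinear.tendsto[OF bounded_bilinear_blinfun_compose] tendsto_const
        tendsto_blinfun_column K)
qed

text \<open>
  Removing the singularities of a closed loop does not change it off an isolated set. Without this the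
  convention of the value \<open>0\<close> at points without a limit could hide the closed loop.
\<close>

lemma closed_loop_regular_cosparse:
  assumes K: "K \<in> controllers D A B"
  shows "\<forall>\<^sub>\<approx>s\<in>right_half_plane. has_bounded_inverse D (loop_op A B K s) \<and>
    op_remove_sings (closed_loop D A B H R K) s = closed_loop D A B H R K s"
proof -
  let ?P = "\<lambda>s. has_bounded_inverse D (loop_op A B K s)"
  note op = eventually_cosparse_open_eq[OF open_right_half_plane]
  have P: "\<forall>\<^sub>\<approx>s\<in>right_half_plane. ?P s"
    and cont: "\<forall>\<^sub>\<approx>s\<in>right_half_plane. K \<midarrow>s\<rightarrow> K s"
    using K op_meromorphic_on_continuous_cosparse[OF _ open_right_half_plane]
    by (auto simp: controllers_def)
  have "\<forall>\<^sub>\<approx>s\<in>right_half_plane. s \<in> right_half_plane"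
    by (rule eventually_in_cosparse[OF order_refl open_right_half_plane])
  with P cont show ?thesis
  proof eventually_elim
    case (elim s)
    then have "\<forall>\<^sub>F x in at s. ?P x"
      using P op by blast
    with elim show ?case
      by (intro conjI op_remove_sings_eq closed_loop_continuous)
  qed
qed

section \<open>Self-adjoint operators\<close>

lemma selfadjoint_op_iff:
  assumes "selfadjoint_op D A"
  shows "(\<forall>x\<in>D. cinner (A x) y = cinner x w) \<longleftrightarrow> y \<in> D \<and> w = A y"
proof -
  have "(y, w) \<in> {(y, w). \<forall>x\<in>D. cinner (A x) y = cinner x w} \<longleftrightarrow> (y, w) \<in> {(y, A y) | y. y \<in> D}"
    using assms unfolding selfadjoint_op_def by simp
  then show ?thesis by auto
qed

text \<open>The linearity of \<open>A\<close> is a consequence: the graph of an adjoint is a linear subspace.\<close>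

lemma
  assumes sa: "selfadjoint_op D A"
  shows selfadjoint_op_sym: "x \<in> D \<Longrightarrow> y \<in> D \<Longrightarrow> cinner (A x) y = cinner x (A y)"
    and selfadjoint_op_add: "x \<in> D \<Longrightarrow> y \<in> D \<Longrightarrow> x + y \<in> D \<and> A (x + y) = A x + A y"
    and selfadjoint_op_scaleC: "x \<in> D \<Longrightarrow> c *\<^sub>C x \<in> D \<and> A (c *\<^sub>C x) = c *\<^sub>C A x"
    and selfadjoint_op_subspace: "subspace D"
proof -
  note iff = selfadjoint_op_iff[OF sa]
  show sym: "cinner (A x) y = cinner x (A y)" if "x \<in> D" "y \<in> D" for x y
    using iff[of y "A y"] that by simp
  show add: "x + y \<in> D \<and> A (x + y) = A x + A y" if "x \<in> D" "y \<in> D" for x y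
    using iff[of "x + y" "A x + A y"] that by (auto simp: cinner_add_right sym)
  show sc: "c *\<^sub>C x \<in> D \<and> A (c *\<^sub>C x) = c *\<^sub>C A x" if "x \<in> D" for c x
    using iff[of "c *\<^sub>C x" "c *\<^sub>C A x"] that by (auto simp: cinner_scaleC_right sym)
  have "0 \<in> D"
    using iff[of 0 0] cinner_scaleC_right[of _ 0 0] by (metis mult_zero_left scaleC_zero_left complex_cnj_zero)
  then show "subspace D"
    using add sc[of _ "of_real _"] unfolding subspace_def by (auto simp: scaleC_of_real)
qed

lemma inner_scaleC_real:
  assumes "cinner x y = cinner y x"
  shows "inner (s *\<^sub>C x) y = Re s * inner x y"
proof -
  have "Im (cinner x y) = 0"
    using assms arg_cong[OF cinner_commute[of x y], of Im] by simp
  then show ?thesis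
    by (simp add: cinner_scaleC_left flip: Re_cinner)
qed

text \<open>
  The functional \<open>x \<mapsto> \<langle>x, h\<rangle>\<close>, represented relative to \<open>A\<close> by \<open>q\<close>, satisfies
  \<open>\<langle>A x, q\<rangle> = \<langle>x, h\<rangle>\<close> on the domain, which by self-adjointness means \<open>A q = h\<close>.
\<close>

lemma selfadjoint_strictly_negative_has_bounded_inverse:
  fixes A :: "'a::{complex_inner, complete_space} \<Rightarrow> 'a"
  assumes sa: "selfadjoint_op D A" and neg: "strictly_negative_op D A"
  shows "has_bounded_inverse D A"
proof -
  obtain m where m: "m > 0" and co: "\<And>z. z \<in> D \<Longrightarrow> m * (norm z)\<^sup>2 \<le> inner (- A z) z"
    using neg unfolding strictly_negative_op_def coercive_op_def by (auto simp: Re_cinner)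
  have below: "m * norm x \<le> norm (A x)" if "x \<in> D" for x
  proof (cases "x = 0")
    case False
    have "m * (norm x)\<^sup>2 \<le> norm (- A x) * norm x"
      using co[OF that] norm_cauchy_schwarz[of "- A x" x] by linarith
    then show ?thesis
      using False by (simp add: power2_eq_square mult.assoc[symmetric])
  qed simp
  note add = selfadjoint_op_add[OF sa] and sc = selfadjoint_op_scaleC[OF sa]
  have scR: "A (r *\<^sub>R x) = r *\<^sub>R A x" if "x \<in> D" for r x
    using sc[OF that, of "of_real r"] by (simp add: scaleC_of_real)
  have "\<exists>q\<in>D. A q = h" for h
  proof -
    have "\<bar>inner x h\<bar> \<le> norm h / m * norm (A x)" if "x \<in> D" for x
    proof -
      have "\<bar>inner x h\<bar> \<le> norm x * norm h"
        by (rule Cauchy_Schwarz_ineq2)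
      also have "\<dots> \<le> (norm (A x) / m) * norm h"
        using below[OF that] m by (intro mult_right_mono) (simp_all add: field_simps)
      finally show ?thesis by (simp add: mult.commute)
    qed
    then obtain q where q: "\<And>x. x \<in> D \<Longrightarrow> inner x h = inner (A x) q"
      using riesz_relative[of D A "\<lambda>x. inner x h" "norm h / m"] selfadjoint_op_subspace[OF sa] add scR
      by (auto simp: inner_add_left)
    have "cinner (A x) q = cinner x h" if "x \<in> D" for x
      using q sc[OF that] by (intro cinner_eq_if_inner_eq) metis
    then show ?thesis
      using selfadjoint_op_iff[OF sa, of q h] by blast
  qed
  then show ?thesis
    using bounded_below_surj_imp_inverse(1)[OF selfadjoint_op_subspace[OF sa] _ scR m below] add
    by blast
qed

lemma selfadjoint_op_inverse_sym:
  assumes sa: "selfadjoint_op D A" and inv: "has_bounded_inverse D A"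
  shows "cinner (blinfun_apply (op_inverse D A) x) y = cinner x (blinfun_apply (op_inverse D A) y)"
  using selfadjoint_op_sym[OF sa op_inverse_in[OF inv, of x] op_inverse_in[OF inv, of y]]
  by (simp add: op_inverse_right[OF inv])

section \<open>The plant and its closed loop\<close>

text \<open>
  A plant \<open>z' = A z + B u + H d\<close> with regulated output \<open>(z, R u)\<close>, with \<open>A\<close> self-adjoint and
  strictly negative and \<open>R\<^sup>* R\<close> coercive.
\<close>

locale selfadjoint_plant =
  fixes D :: "'z::{complex_inner, complete_space} set" and A :: "'z \<Rightarrow> 'z"
    and B :: "'u::{complex_inner, complete_space} \<Rightarrow>\<^sub>L 'z"
    and H :: "'d::{complex_inner, complete_space} \<Rightarrow>\<^sub>L 'z"
    and R :: "'u \<Rightarrow>\<^sub>L 'r::complex_inner"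
  assumes B: "B \<in> cblinfun" and H: "H \<in> cblinfun" and R: "R \<in> cblinfun"
    and gram: "coercive_op UNIV (blinfun_apply (cadjoint R o\<^sub>L R))"
    and sa: "selfadjoint_op D A" and neg: "strictly_negative_op D A"
begin

abbreviation "G\<^sub>i \<equiv> inverse_gram R"

abbreviation "A\<^sub>i \<equiv> op_inverse D A"

lemmas A_inv = selfadjoint_strictly_negative_has_bounded_inverse[OF sa neg]

lemmas A_scaleC = selfadjoint_op_scaleC[OF sa]

lemma A_minus: "x \<in> D \<Longrightarrow> - x \<in> D \<and> A (- x) = - A x"
  using A_scaleC[of x "-1"] by simp

lemma Ai_in [simp]: "blinfun_apply A\<^sub>i y \<in> D"
  and A_Ai [simp]: "A (blinfun_apply A\<^sub>i y) = y"
  and Ai_A: "x \<in> D \<Longrightarrow> blinfun_apply A\<^sub>i (A x) = x"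
  using op_inverse_in[OF A_inv] op_inverse_right[OF A_inv] op_inverse_left[OF A_inv] by auto

lemma Ai_cblinfun: "A\<^sub>i \<in> cblinfun"
  by (rule op_inverse_cblinfun[OF A_inv]) (auto simp: A_scaleC)

lemmas Ai_sym = selfadjoint_op_inverse_sym[OF sa A_inv]

lemma A_nonpos: "x \<in> D \<Longrightarrow> inner (A x) x \<le> 0"
proof -
  assume x: "x \<in> D"
  obtain m where "m > 0" "m * (norm x)\<^sup>2 \<le> Re (cinner (- A x) x)"
    using neg x unfolding strictly_negative_op_def coercive_op_def by auto
  moreover have "0 \<le> m * (norm x)\<^sup>2"
    using \<open>m > 0\<close> by simp
  ultimately show ?thesis
    unfolding Re_cinner inner_minus_left by linarith
qed

lemma scaleC_Ai_inner: "inner (s *\<^sub>C blinfun_apply A\<^sub>i x) x \<le> 0" if "0 \<le> Re s"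
proof -
  have "cinner (blinfun_apply A\<^sub>i x) x = cinner x (blinfun_apply A\<^sub>i x)"
    by (rule Ai_sym)
  moreover have "inner (blinfun_apply A\<^sub>i x) x \<le> 0"
    using A_nonpos[of "blinfun_apply A\<^sub>i x"] by (simp add: inner_commute)
  ultimately show ?thesis
    using that by (simp add: inner_scaleC_real mult_nonneg_nonpos)
qed

lemma gram_inner:
  "inner (blinfun_apply (cadjoint R o\<^sub>L R) u) v = inner (blinfun_apply R u) (blinfun_apply R v)"
  using inner_cadjoint[OF R, of v "blinfun_apply R u"] by (simp add: inner_commute)

lemma gram_inv: "has_bounded_inverse UNIV (blinfun_apply (cadjoint R o\<^sub>L R))"
proof -
  obtain m where m: "m > 0"
    and co: "\<And>u. m * (norm u)\<^sup>2 \<le> inner (blinfun_apply (cadjoint R o\<^sub>L R) u) u"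
    using gram unfolding coercive_op_def Re_cinner by auto
  have below: "m * norm u \<le> norm (blinfun_apply (cadjoint R o\<^sub>L R) u)" for u
  proof (cases "u = 0")
    case False
    have "m * norm u * norm u \<le> norm (blinfun_apply (cadjoint R o\<^sub>L R) u) * norm u"
      using order_trans[OF co norm_cauchy_schwarz] by (simp add: power2_eq_square mult.assoc)
    then show ?thesis
      using False by simp
  qed simp
  show ?thesis
  proof (rule bounded_adjoint_pair_inverse(1)[OF _ m below below])
    show "inner (blinfun_apply (cadjoint R o\<^sub>L R) x) y = inner x (blinfun_apply (cadjoint R o\<^sub>L R) y)" for x y
      by (simp only: gram_inner inner_commute[of x])
        (simp only: inner_commute)
  qed
qed

lemma gram_Gi [simp]:
  "blinfun_apply (cadjoint R) (blinfun_apply R (blinfun_apply G\<^sub>i v)) = v"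
  using op_inverse_right[OF gram_inv, of v] unfolding inverse_gram_def by simp

lemma Gi_inner:
  "inner (blinfun_apply G\<^sub>i v) w
    = inner (blinfun_apply R (blinfun_apply G\<^sub>i v)) (blinfun_apply R (blinfun_apply G\<^sub>i w))"
  by (simp add: inner_cadjoint[OF R])

lemma Gi_cblinfun: "G\<^sub>i \<in> cblinfun"
  unfolding inverse_gram_def
  by (rule op_inverse_cblinfun[OF gram_inv])
    (simp_all add: cblinfunD[OF R] cblinfunD[OF cadjoint_cblinfun[OF R]])

text \<open>The positive operator \<open>S = B (R\<^sup>* R)\<^sup>-\<^sup>1 B\<^sup>*\<close>.\<close>

definition "S = B o\<^sub>L G\<^sub>i o\<^sub>L cadjoint B"

lemma S_cblinfun: "S \<in> cblinfun"
  unfolding S_def by (intro cblinfun_compose B Gi_cblinfun cadjoint_cblinfun)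

lemma S_inner: "inner (blinfun_apply S x) y
    = inner (blinfun_apply R (blinfun_apply G\<^sub>i (blinfun_apply (cadjoint B) x)))
        (blinfun_apply R (blinfun_apply G\<^sub>i (blinfun_apply (cadjoint B) y)))"
  unfolding S_def by (simp add: inner_cadjoint[OF B] Gi_inner)

lemma S_sym: "inner (blinfun_apply S x) y = inner x (blinfun_apply S y)"
  using S_inner[of x y] S_inner[of y x] by (simp add: inner_commute)

lemma S_self: "inner (blinfun_apply S x) x
    = (norm (blinfun_apply R (blinfun_apply G\<^sub>i (blinfun_apply (cadjoint B) x))))\<^sup>2"
  by (simp add: S_inner power2_norm_eq_inner)

text \<open>
  The bounded factor \<open>C s = I - s A\<^sup>-\<^sup>1 + A\<^sup>-\<^sup>1 S A\<^sup>-\<^sup>1\<close>, whose real part is at least \<open>I\<close> for \<open>Re s \<ge> 0\<close>.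
  On the respective domains \<open>s I - A - S A\<^sup>-\<^sup>1 = - A C(s)\<close> and \<open>A\<^sup>2 + S = A C(0) A\<close>, so that the
  inverse of \<open>C\<close> inverts both unbounded operators.
\<close>

definition C :: "complex \<Rightarrow> 'z \<Rightarrow>\<^sub>L 'z" where
  "C s = id_blinfun - scaleC_blinfun s A\<^sub>i + (A\<^sub>i o\<^sub>L S o\<^sub>L A\<^sub>i)"

definition C\<^sub>i :: "complex \<Rightarrow> 'z \<Rightarrow>\<^sub>L 'z" where
  "C\<^sub>i s = op_inverse UNIV (blinfun_apply (C s))"

lemma C_apply: "blinfun_apply (C s) z = z - s *\<^sub>C blinfun_apply A\<^sub>i z
    + blinfun_apply A\<^sub>i (blinfun_apply S (blinfun_apply A\<^sub>i z))"
  by (simp add: C_def blinfun.bilinear_simps)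

lemma C_cblinfun: "C s \<in> cblinfun"
  by (rule cblinfunI)
    (simp add: C_apply cblinfunD[OF Ai_cblinfun] cblinfunD[OF S_cblinfun] scaleC_add_right
      scaleC_diff_right scaleC_scaleC mult.commute)

lemma Ai_sym_inner: "inner (blinfun_apply A\<^sub>i x) y = inner x (blinfun_apply A\<^sub>i y)"
  by (metis Re_cinner Ai_sym)

lemma C_adjoint: "inner (blinfun_apply (C s) x) y = inner x (blinfun_apply (C (cnj s)) y)"
proof -
  have "inner (s *\<^sub>C blinfun_apply A\<^sub>i x) y = inner x (cnj s *\<^sub>C blinfun_apply A\<^sub>i y)"
    by (simp only: Re_cinner[symmetric] cinner_scaleC_left cinner_scaleC_right Ai_sym
        complex_cnj_cnj)
  then show ?thesis
    by (simp add: C_apply inner_add_left inner_add_right inner_diff_left inner_diff_right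
        Ai_sym_inner S_sym)
qed

lemma C_below:
  assumes "0 \<le> Re s"
  shows "norm z \<le> norm (blinfun_apply (C s) z)"
proof (cases "z = 0")
  case False
  have "0 \<le> inner (blinfun_apply A\<^sub>i (blinfun_apply S (blinfun_apply A\<^sub>i z))) z"
    using S_self[of "blinfun_apply A\<^sub>i z"] by (simp add: Ai_sym_inner)
  then have "(norm z)\<^sup>2 \<le> inner (blinfun_apply (C s) z) z"
    using scaleC_Ai_inner[OF assms, of z]
    by (simp add: C_apply inner_add_left inner_diff_left power2_norm_eq_inner)
  also have "\<dots> \<le> norm (blinfun_apply (C s) z) * norm z"
    by (rule norm_cauchy_schwarz)
  finally show ?thesis
    using False by (simp add: power2_eq_square)
qed simp

lemma
  assumes "0 \<le> Re s"
  shows C_inv: "has_bounded_inverse UNIV (blinfun_apply (C s))"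
    and norm_Ci: "norm (C\<^sub>i s) \<le> 1"
proof -
  have below: "1 * norm x \<le> norm (blinfun_apply (C s) x)"
    "1 * norm x \<le> norm (blinfun_apply (C (cnj s)) x)" for x
    using C_below[of s] C_below[of "cnj s"] assms by auto
  have adj: "inner (blinfun_apply (C (cnj s)) x) y = inner x (blinfun_apply (C s) y)" for x y
    using C_adjoint[of "cnj s"] by simp
  show "has_bounded_inverse UNIV (blinfun_apply (C s))"
    by (rule bounded_adjoint_pair_inverse(1)[OF adj zero_less_one below])
  show "norm (C\<^sub>i s) \<le> 1"
    unfolding C\<^sub>i_def using bounded_adjoint_pair_inverse(2)[OF adj zero_less_one below] by simp
qed

lemma
  assumes "0 \<le> Re s"
  shows C_Ci: "blinfun_apply (C s) (blinfun_apply (C\<^sub>i s) y) = y"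
    and Ci_C: "blinfun_apply (C\<^sub>i s) (blinfun_apply (C s) y) = y"
    and Ci_cblinfun: "C\<^sub>i s \<in> cblinfun"
  unfolding C\<^sub>i_def
  by (auto intro!: op_inverse_right[OF C_inv] op_inverse_left[OF C_inv] op_inverse_cblinfun[OF C_inv]
      simp: assms cblinfunD[OF C_cblinfun])

lemma Ci_Ai:
  assumes "0 \<le> Re s"
  defines "w \<equiv> \<lambda>y. blinfun_apply (C\<^sub>i s) (blinfun_apply A\<^sub>i y)"
  shows "w y \<in> D" and "A (w y) = y + s *\<^sub>C w y - blinfun_apply S (blinfun_apply A\<^sub>i (w y))"
proof -
  have "w y - s *\<^sub>C blinfun_apply A\<^sub>i (w y)
      + blinfun_apply A\<^sub>i (blinfun_apply S (blinfun_apply A\<^sub>i (w y))) = blinfun_apply A\<^sub>i y"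
    using C_Ci[OF assms(1)] unfolding w_def C_apply by blast
  then have "w y = blinfun_apply A\<^sub>i (y + s *\<^sub>C w y - blinfun_apply S (blinfun_apply A\<^sub>i (w y)))"
    by (simp add: blinfun.bilinear_simps cblinfunD[OF Ai_cblinfun] algebra_simps)
  then show "w y \<in> D" and "A (w y) = y + s *\<^sub>C w y - blinfun_apply S (blinfun_apply A\<^sub>i (w y))"
    by (metis Ai_in, metis A_Ai)
qed

subsection \<open>The operator of the optimal attenuation\<close>

text \<open>\<open>M = A\<^sup>2 + B (R\<^sup>* R)\<^sup>-\<^sup>1 B\<^sup>*\<close>, a total function here; only its values on \<open>D(A\<^sup>2)\<close> matter.\<close>

definition "M z = A (A z) + blinfun_apply S z"

text \<open>The inverse of \<open>M\<close> restricted to \<open>D(A\<^sup>2)\<close>.\<close>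

definition "W = A\<^sub>i o\<^sub>L C\<^sub>i 0 o\<^sub>L A\<^sub>i"

lemma W_M:
  assumes "z \<in> D" "A z \<in> D"
  shows "blinfun_apply W (M z) = z"
proof -
  have "blinfun_apply A\<^sub>i (M z) = blinfun_apply (C 0) (A z)"
    unfolding M_def C_apply using assms by (simp add: blinfun.add_right Ai_A)
  then show ?thesis
    unfolding W_def using assms by (simp add: Ci_C Ai_A)
qed

lemma W_in: "blinfun_apply W y \<in> D" "A (blinfun_apply W y) \<in> D"
  unfolding W_def using Ci_Ai(1)[of 0] by simp_all

lemma M_W: "M (blinfun_apply W y) = y"
  unfolding M_def W_def using Ci_Ai(2)[of 0 y] by simp

lemma op_inverse_M: "op_inverse {z \<in> D. A z \<in> D} M = W"
  by (rule has_bounded_inverseI) (auto simp: W_M W_in M_W)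

lemma M_inner:
  assumes "p \<in> D" "A p \<in> D"
  shows "inner p (M p)
    = (norm (A p))\<^sup>2 + (norm (blinfun_apply R (blinfun_apply G\<^sub>i (blinfun_apply (cadjoint B) p))))\<^sup>2"
proof -
  have "inner p (A (A p)) = inner (A p) (A p)"
    using selfadjoint_op_sym[OF sa assms] by (metis Re_cinner)
  then show ?thesis
    unfolding M_def by (simp add: inner_add_right power2_norm_eq_inner[of "A p"] flip: S_self)
      (simp add: inner_commute)
qed

lemma W_sym: "inner (blinfun_apply W x) y = inner x (blinfun_apply W y)"
proof -
  have "inner (blinfun_apply (C\<^sub>i 0) u) v = inner u (blinfun_apply (C\<^sub>i 0) v)" for u v
    using C_adjoint[of 0 "blinfun_apply (C\<^sub>i 0) u" "blinfun_apply (C\<^sub>i 0) v"] by (simp add: C_Ci)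
  then show ?thesis
    unfolding W_def by (simp add: Ai_sym_inner)
qed

lemma W_nonneg: "0 \<le> inner (blinfun_apply W y) y"
  using M_inner[OF W_in, of y] by (simp add: M_W)

subsection \<open>The optimal feedback\<close>

text \<open>The static feedback \<open>(R\<^sup>* R)\<^sup>-\<^sup>1 B\<^sup>* A\<^sup>-\<^sup>1\<close>.\<close>

definition "K\<^sub>o = G\<^sub>i o\<^sub>L cadjoint B o\<^sub>L A\<^sub>i"

lemma Ko_cblinfun: "K\<^sub>o \<in> cblinfun"
  unfolding K\<^sub>o_def by (intro cblinfun_compose Gi_cblinfun cadjoint_cblinfun B Ai_cblinfun)

lemma
  assumes s: "0 \<le> Re s"
  shows Ko_loop_inv: "has_bounded_inverse D (loop_op A B (\<lambda>_. K\<^sub>o) s)"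
    and op_inverse_Ko_loop: "op_inverse D (loop_op A B (\<lambda>_. K\<^sub>o) s) = - (C\<^sub>i s o\<^sub>L A\<^sub>i)"
proof -
  have loop: "loop_op A B (\<lambda>_. K\<^sub>o) s z = s *\<^sub>C z - A z - blinfun_apply S (blinfun_apply A\<^sub>i z)" for z
    unfolding loop_op_def K\<^sub>o_def S_def by simp
  have left: "blinfun_apply (- (C\<^sub>i s o\<^sub>L A\<^sub>i)) (loop_op A B (\<lambda>_. K\<^sub>o) s z) = z" if "z \<in> D" for z
  proof -
    have "blinfun_apply A\<^sub>i (loop_op A B (\<lambda>_. K\<^sub>o) s z) = - blinfun_apply (C s) z"
      unfolding loop C_apply using that
      by (simp add: blinfun.bilinear_simps cblinfunD[OF Ai_cblinfun] Ai_A)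
    then show ?thesis
      by (simp add: blinfun.bilinear_simps Ci_C[OF s])
  qed
  have into: "blinfun_apply (- (C\<^sub>i s o\<^sub>L A\<^sub>i)) y \<in> D" for y
    using Ci_Ai(1)[OF s] A_minus by (simp add: blinfun.minus_left)
  have right: "loop_op A B (\<lambda>_. K\<^sub>o) s (blinfun_apply (- (C\<^sub>i s o\<^sub>L A\<^sub>i)) y) = y" for y
    unfolding loop using Ci_Ai[OF s, of y] A_minus[OF Ci_Ai(1)[OF s, of y]]
    by (simp add: blinfun.bilinear_simps)
  show "has_bounded_inverse D (loop_op A B (\<lambda>_. K\<^sub>o) s)"
    and "op_inverse D (loop_op A B (\<lambda>_. K\<^sub>o) s) = - (C\<^sub>i s o\<^sub>L A\<^sub>i)"
    using has_bounded_inverseI[of D "- (C\<^sub>i s o\<^sub>L A\<^sub>i)", OF left into right] by simp_all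
qed

text \<open>
  With \<open>p = - A\<^sup>-\<^sup>1 z\<close> the closed-loop equation reads \<open>(M - s A) p = h\<close>, and
  \<open>\<langle>M\<^sup>-\<^sup>1 h, h\<rangle> = \<langle>p, M p\<rangle> - 2 Re s \<langle>p, A p\<rangle> + \<langle>M\<^sup>-\<^sup>1 s A p, s A p\<rangle>\<close>, where the last two terms are
  nonnegative and \<open>\<langle>p, M p\<rangle>\<close> is the squared norm of the output.
\<close>

lemma Ko_output_le:
  assumes s: "0 \<le> Re s" and z: "z \<in> D" and eq: "loop_op A B (\<lambda>_. K\<^sub>o) s z = h"
  shows "(norm z)\<^sup>2 + (norm (blinfun_apply R (blinfun_apply K\<^sub>o z)))\<^sup>2 \<le> inner (blinfun_apply W h) h"
proof -
  define p where "p = - blinfun_apply A\<^sub>i z"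
  have p: "p \<in> D" "A p = - z" "A p \<in> D"
    using A_minus[of "blinfun_apply A\<^sub>i z"] A_minus[OF z] unfolding p_def by auto
  define q where "q = s *\<^sub>C A p"
  have h: "h = M p - q"
    unfolding eq[symmetric] loop_op_def K\<^sub>o_def M_def q_def p(2) S_def
    using A_minus[OF z] by (simp add: p_def blinfun.bilinear_simps)
  have Wh: "blinfun_apply W h = p - blinfun_apply W q"
    unfolding h by (simp add: blinfun.diff_right W_M[OF p(1,3)])
  have "inner (blinfun_apply W q) (M p) = inner q p"
    by (simp add: W_sym W_M[OF p(1,3)])
  then have "inner (blinfun_apply W h) h
      = inner p (M p) - 2 * inner q p + inner (blinfun_apply W q) q"
    unfolding Wh by (simp add: h inner_diff_left inner_diff_right inner_commute)
  moreover have "inner q p = Re s * inner (A p) p"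
    unfolding q_def using selfadjoint_op_sym[OF sa p(1,1)] by (rule inner_scaleC_real)
  moreover have "Re s * inner (A p) p \<le> 0"
    using s A_nonpos[OF p(1)] by (rule mult_nonneg_nonpos)
  moreover have "inner p (M p) = (norm z)\<^sup>2 + (norm (blinfun_apply R (blinfun_apply K\<^sub>o z)))\<^sup>2"
    unfolding M_inner[OF p(1,3)] p(2) by (simp add: p_def K\<^sub>o_def blinfun.bilinear_simps)
  ultimately show ?thesis
    using W_nonneg[of q] by linarith
qed

text \<open>
  Duality with the minimal output at \<open>s = 0\<close>: for \<open>p = M\<^sup>-\<^sup>1 h\<close>, the pair \<open>(-A p, -R (R\<^sup>* R)\<^sup>-\<^sup>1 B\<^sup>* p)\<close>
  has squared norm \<open>\<langle>p, h\<rangle>\<close> and inner product \<open>\<langle>h - s z, p\<rangle>\<close> with \<open>(z, R u)\<close>.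
\<close>

lemma output_ge:
  assumes z: "z \<in> D" and eq: "s *\<^sub>C z - A z - blinfun_apply B u = h"
  defines "J \<equiv> inner (blinfun_apply W h) h"
  shows "J \<le> norm (z, blinfun_apply R u) * sqrt J + cmod s * norm z * norm (blinfun_apply W h)"
proof -
  define p where "p = blinfun_apply W h"
  have p: "p \<in> D" "A p \<in> D" "M p = h"
    unfolding p_def by (simp_all add: W_in M_W)
  define v where "v = blinfun_apply G\<^sub>i (blinfun_apply (cadjoint B) p)"
  define y where "y = (- A p, - blinfun_apply R v)"
  have "J = inner p (M p)"
    unfolding J_def p(3) by (simp add: p_def)
  then have "J = (norm y)\<^sup>2"
    unfolding M_inner[OF p(1,2)] y_def v_def norm_Pair_sq by simp
  then have y: "norm y = sqrt J"
    by simp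
  have "inner (blinfun_apply R u) (blinfun_apply R v) = inner (blinfun_apply B u) p"
    unfolding v_def by (simp add: inner_cadjoint[OF R] inner_cadjoint[OF B])
  moreover have "inner z (A p) = inner (A z) p"
    using selfadjoint_op_sym[OF sa z p(1)] by (metis Re_cinner)
  ultimately have "inner (z, blinfun_apply R u) y = inner (h - s *\<^sub>C z) p"
    unfolding y_def by (simp add: inner_add_left inner_diff_left flip: eq)
  then have "J = inner (z, blinfun_apply R u) y + inner (s *\<^sub>C z) p"
    unfolding J_def p_def by (simp add: inner_diff_left inner_commute)
  also have "\<dots> \<le> norm (z, blinfun_apply R u) * norm y + norm (s *\<^sub>C z) * norm p"
    by (intro add_mono norm_cauchy_schwarz)
  finally show ?thesis
    by (simp add: y norm_scaleC p_def)
qed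

subsection \<open>The optimal attenuation\<close>

text \<open>The operator \<open>H\<^sup>* M\<^sup>-\<^sup>1 H\<close>, whose norm is the square of the optimal attenuation.\<close>

definition "Q = cadjoint H o\<^sub>L W o\<^sub>L H"

lemma Q_inner: "inner (blinfun_apply Q d) e
    = inner (blinfun_apply W (blinfun_apply H d)) (blinfun_apply H e)"
  unfolding Q_def
  using inner_cadjoint[OF H, of e "blinfun_apply W (blinfun_apply H d)"] by (simp add: inner_commute)

lemma norm_Q_le:
  assumes "0 \<le> g" and "\<And>d. inner (blinfun_apply Q d) d \<le> g * (norm d)\<^sup>2"
  shows "norm Q \<le> g"
proof (rule norm_symmetric_positive_le)
  show "inner (blinfun_apply Q x) y = inner x (blinfun_apply Q y)" for x y
    using Q_inner[of x y] Q_inner[of y x] by (metis W_sym inner_commute)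
qed (use assms in \<open>simp_all add: Q_inner W_nonneg\<close>)

lemma Q_le: "inner (blinfun_apply Q d) d \<le> norm Q * (norm d)\<^sup>2"
proof -
  have "inner (blinfun_apply Q d) d \<le> norm (blinfun_apply Q d) * norm d"
    by (rule norm_cauchy_schwarz)
  also have "\<dots> \<le> norm Q * norm d * norm d"
    by (intro mult_right_mono norm_blinfun) simp
  finally show ?thesis
    by (simp add: power2_eq_square mult.assoc)
qed

lemma norm_Ko_closed_loop_le:
  assumes s: "0 \<le> Re s"
  shows "norm (closed_loop D A B H R (\<lambda>_. K\<^sub>o) s) \<le> sqrt (norm Q)"
proof (rule norm_blinfun_bound)
  fix d
  define z where "z = blinfun_apply (op_inverse D (loop_op A B (\<lambda>_. K\<^sub>o) s)) (blinfun_apply H d)"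
  have "(norm z)\<^sup>2 + (norm (blinfun_apply R (blinfun_apply K\<^sub>o z)))\<^sup>2 \<le> inner (blinfun_apply Q d) d"
    unfolding Q_inner z_def using Ko_loop_inv[OF s]
    by (intro Ko_output_le[OF s] op_inverse_in op_inverse_right)
  also have "\<dots> \<le> (sqrt (norm Q) * norm d)\<^sup>2"
    using Q_le by (simp add: power_mult_distrib)
  finally have "(norm (blinfun_apply (closed_loop D A B H R (\<lambda>_. K\<^sub>o) s) d))\<^sup>2 \<le> (sqrt (norm Q) * norm d)\<^sup>2"
    unfolding closed_loop_def by (simp add: norm_Pair_sq z_def)
  then show "norm (blinfun_apply (closed_loop D A B H R (\<lambda>_. K\<^sub>o) s) d) \<le> sqrt (norm Q) * norm d"
    by (rule power2_le_imp_le) simp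
qed simp

subsection \<open>The optimal feedback is stabilizing\<close>

lemma Ci_diff:
  assumes "0 \<le> Re s" "0 \<le> Re t"
  shows "C\<^sub>i t - C\<^sub>i s = scaleC_blinfun (t - s) (C\<^sub>i t o\<^sub>L A\<^sub>i o\<^sub>L C\<^sub>i s)"
proof (rule blinfun_eqI)
  fix y
  define w where "w = blinfun_apply (C\<^sub>i s) y"
  have "y = blinfun_apply (C s) w"
    unfolding w_def by (simp add: C_Ci assms)
  also have "\<dots> = blinfun_apply (C t) w + (t - s) *\<^sub>C blinfun_apply A\<^sub>i w"
    by (simp add: C_apply scaleC_diff_left)
  finally have "blinfun_apply (C\<^sub>i t) y = w + (t - s) *\<^sub>C blinfun_apply (C\<^sub>i t) (blinfun_apply A\<^sub>i w)"
    by (simp add: blinfun.add_right Ci_C assms cblinfunD[OF Ci_cblinfun])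
  then show "blinfun_apply (C\<^sub>i t - C\<^sub>i s) y
      = blinfun_apply (scaleC_blinfun (t - s) (C\<^sub>i t o\<^sub>L A\<^sub>i o\<^sub>L C\<^sub>i s)) y"
    by (simp add: blinfun.diff_left w_def)
qed

lemma norm_Ci_Ai_Ci_le:
  assumes "0 \<le> Re s" "0 \<le> Re t"
  shows "norm (C\<^sub>i t o\<^sub>L A\<^sub>i o\<^sub>L C\<^sub>i s) \<le> norm A\<^sub>i"
proof -
  have "norm (C\<^sub>i t o\<^sub>L A\<^sub>i o\<^sub>L C\<^sub>i s) \<le> norm (C\<^sub>i t o\<^sub>L A\<^sub>i) * norm (C\<^sub>i s)"
    by (rule norm_blinfun_compose)
  also have "\<dots> \<le> (norm (C\<^sub>i t) * norm A\<^sub>i) * norm (C\<^sub>i s)"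
    by (intro mult_right_mono norm_blinfun_compose) simp
  also have "\<dots> \<le> (1 * norm A\<^sub>i) * 1"
    by (intro mult_mono norm_Ci assms) auto
  finally show ?thesis by simp
qed

lemma Ci_has_derivative:
  assumes s: "s \<in> right_half_plane"
  shows "(C\<^sub>i has_derivative (\<lambda>h. scaleC_blinfun h (C\<^sub>i s o\<^sub>L A\<^sub>i o\<^sub>L C\<^sub>i s))) (at s within right_half_plane)"
proof -
  have *: "norm (C\<^sub>i t - C\<^sub>i s - scaleC_blinfun (t - s) (C\<^sub>i s o\<^sub>L A\<^sub>i o\<^sub>L C\<^sub>i s)) / norm (t - s)
      \<le> norm (t - s) * (norm A\<^sub>i * norm A\<^sub>i)" if t: "t \<in> right_half_plane" "t \<noteq> s" for t
  proof -
    have re: "0 \<le> Re s" "0 \<le> Re t"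
      using s t by (auto simp: right_half_plane_def)
    let ?L = "A\<^sub>i o\<^sub>L C\<^sub>i s"
    have "C\<^sub>i t - C\<^sub>i s - scaleC_blinfun (t - s) (C\<^sub>i s o\<^sub>L ?L)
        = scaleC_blinfun (t - s) (C\<^sub>i t o\<^sub>L ?L) - scaleC_blinfun (t - s) (C\<^sub>i s o\<^sub>L ?L)"
      using Ci_diff[OF re] by (simp add: blinfun_compose_assoc)
    also have "\<dots> = scaleC_blinfun (t - s) ((C\<^sub>i t - C\<^sub>i s) o\<^sub>L ?L)"
      by (rule blinfun_eqI) (simp add: blinfun.diff_left scaleC_diff_right)
    finally have "norm (C\<^sub>i t - C\<^sub>i s - scaleC_blinfun (t - s) (C\<^sub>i s o\<^sub>L ?L))
        = cmod (t - s) * norm ((C\<^sub>i t - C\<^sub>i s) o\<^sub>L ?L)"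
      by (simp add: norm_scaleC_blinfun)
    also have "norm ((C\<^sub>i t - C\<^sub>i s) o\<^sub>L ?L) \<le> norm (C\<^sub>i t - C\<^sub>i s) * norm ?L"
      by (rule norm_blinfun_compose)
    also have "\<dots> \<le> (cmod (t - s) * norm A\<^sub>i) * norm A\<^sub>i"
    proof (rule mult_mono)
      show "norm (C\<^sub>i t - C\<^sub>i s) \<le> cmod (t - s) * norm A\<^sub>i"
        unfolding Ci_diff[OF re] norm_scaleC_blinfun
        by (intro mult_left_mono norm_Ci_Ai_Ci_le re) simp
      have "norm ?L \<le> norm A\<^sub>i * norm (C\<^sub>i s)"
        by (rule norm_blinfun_compose)
      also have "\<dots> \<le> norm A\<^sub>i * 1"
        by (intro mult_left_mono norm_Ci re) simp
      finally show "norm ?L \<le> norm A\<^sub>i" by simp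
    qed auto
    finally have "norm (C\<^sub>i t - C\<^sub>i s - scaleC_blinfun (t - s) (C\<^sub>i s o\<^sub>L ?L))
        \<le> cmod (t - s) * ((cmod (t - s) * norm A\<^sub>i) * norm A\<^sub>i)"
      by (simp add: mult_left_mono)
    then show ?thesis
      using t(2) by (simp add: blinfun_compose_assoc field_simps)
  qed
  have "((\<lambda>t. norm (t - s) * (norm A\<^sub>i * norm A\<^sub>i)) \<longlongrightarrow> norm (s - s) * (norm A\<^sub>i * norm A\<^sub>i))
      (at s within right_half_plane)"
    by (intro tendsto_intros)
  then have "((\<lambda>t. norm (t - s) * (norm A\<^sub>i * norm A\<^sub>i)) \<longlongrightarrow> 0) (at s within right_half_plane)"
    by simp
  moreover have "bounded_linear (\<lambda>h. scaleC_blinfun h (C\<^sub>i s o\<^sub>L A\<^sub>i o\<^sub>L C\<^sub>i s))"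
    by (rule bounded_bilinear.bounded_linear_left[OF bounded_bilinear_scaleC_blinfun])
  ultimately show ?thesis
    using * by (intro has_derivativeI_sandwich[where e = 1]) auto
qed

lemma Ko_closed_loop_holomorphic:
  "op_holomorphic_on (closed_loop D A B H R (\<lambda>_. K\<^sub>o)) right_half_plane"
  unfolding op_holomorphic_on_def
proof
  fix s assume s: "s \<in> right_half_plane"
  let ?c = "blinfun_column id_blinfun (R o\<^sub>L K\<^sub>o)"
  let ?L = "C\<^sub>i s o\<^sub>L A\<^sub>i o\<^sub>L C\<^sub>i s"
  let ?\<Phi> = "\<lambda>X. ?c o\<^sub>L - (X o\<^sub>L A\<^sub>i) o\<^sub>L H"
  have "bounded_linear ?\<Phi>"
    by (intro bounded_linear_intros bounded_linear_minus
        bounded_linear_compose[OF bounded_bilinear.bounded_linear_left[OF bounded_bilinear_blinfun_compose]]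
        bounded_linear_compose[OF bounded_bilinear.bounded_linear_right[OF bounded_bilinear_blinfun_compose]])
  then have "((\<lambda>t. ?\<Phi> (C\<^sub>i t)) has_derivative (\<lambda>h. ?\<Phi> (scaleC_blinfun h ?L))) (at s within right_half_plane)"
    using Ci_has_derivative[OF s] by (rule bounded_linear.has_derivative)
  moreover have "?\<Phi> (scaleC_blinfun h ?L) = scaleC_blinfun h (?\<Phi> ?L)" for h
    by (rule blinfun_eqI)
      (simp add: blinfun.minus_left blinfun.minus_right scaleC_prod_def cblinfunD[OF R] cblinfunD[OF Ko_cblinfun])
  moreover have "closed_loop D A B H R (\<lambda>_. K\<^sub>o) t = ?\<Phi> (C\<^sub>i t)" if "t \<in> right_half_plane" for t
    using that op_inverse_Ko_loop[of t] by (simp add: closed_loop_def right_half_plane_def)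
  ultimately show "\<exists>L. (closed_loop D A B H R (\<lambda>_. K\<^sub>o) has_derivative (\<lambda>h. scaleC_blinfun h L))
      (at s within right_half_plane)"
    using has_derivative_transform[OF s, of "closed_loop D A B H R (\<lambda>_. K\<^sub>o)" "\<lambda>t. ?\<Phi> (C\<^sub>i t)"]
    by auto
qed

lemma Ko_controller: "(\<lambda>_. K\<^sub>o) \<in> controllers D A B"
proof -
  have "op_holomorphic_on (\<lambda>_. K\<^sub>o) X" for X
    unfolding op_holomorphic_on_def
  proof
    fix s
    have "(\<lambda>h. scaleC_blinfun h (0 :: 'z \<Rightarrow>\<^sub>L 'u)) = (\<lambda>h. 0)"
      by (intro ext blinfun_eqI) simp
    then show "\<exists>L. ((\<lambda>_. K\<^sub>o) has_derivative (\<lambda>h. scaleC_blinfun h L)) (at s within X)"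
      by (metis has_derivative_const)
  qed
  then have "op_meromorphic_on (\<lambda>_. K\<^sub>o) right_half_plane"
    unfolding op_meromorphic_on_def
    by (intro ballI exI[of _ 1] conjI exI[of _ 0] exI[of _ "\<lambda>_. K\<^sub>o"]) simp_all
  moreover have "\<forall>\<^sub>\<approx>s\<in>right_half_plane. s \<in> right_half_plane"
    by (rule eventually_in_cosparse[OF order_refl open_right_half_plane])
  then have "\<forall>\<^sub>\<approx>s\<in>right_half_plane. has_bounded_inverse D (loop_op A B (\<lambda>_. K\<^sub>o) s)"
    by eventually_elim (simp add: right_half_plane_def Ko_loop_inv)
  ultimately show ?thesis
    unfolding controllers_def by (simp add: Ko_cblinfun)
qed

lemma Ko_remove_sings:
  assumes s: "s \<in> right_half_plane"
  shows "op_remove_sings (closed_loop D A B H R (\<lambda>_. K\<^sub>o)) s = closed_loop D A B H R (\<lambda>_. K\<^sub>o) s"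
proof (intro op_remove_sings_eq closed_loop_continuous tendsto_const)
  show "has_bounded_inverse D (loop_op A B (\<lambda>_. K\<^sub>o) s)"
    using s by (simp add: Ko_loop_inv right_half_plane_def)
  show "\<forall>\<^sub>F x in at s. has_bounded_inverse D (loop_op A B (\<lambda>_. K\<^sub>o) x)"
    using eventually_at_in_open'[OF open_right_half_plane s]
    by eventually_elim (simp add: Ko_loop_inv right_half_plane_def)
qed

lemma Ko_stabilizing: "(\<lambda>_. K\<^sub>o) \<in> stabilizing_controllers D A B H R"
proof -
  let ?G = "closed_loop D A B H R (\<lambda>_. K\<^sub>o)"
  have "op_holomorphic_on (op_remove_sings ?G) right_half_plane"
    unfolding op_holomorphic_on_def
  proof
    fix s assume s: "s \<in> right_half_plane"
    then obtain L where "(?G has_derivative (\<lambda>h. scaleC_blinfun h L)) (at s within right_half_plane)"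
      using Ko_closed_loop_holomorphic unfolding op_holomorphic_on_def by blast
    then have "(op_remove_sings ?G has_derivative (\<lambda>h. scaleC_blinfun h L)) (at s within right_half_plane)"
      using s Ko_remove_sings by (intro has_derivative_transform[of s _ "op_remove_sings ?G" ?G])
    then show "\<exists>L. (op_remove_sings ?G has_derivative (\<lambda>h. scaleC_blinfun h L)) (at s within right_half_plane)"
      by blast
  qed
  moreover have "?G s \<in> cblinfun" if "s \<in> right_half_plane" for s
  proof (rule cblinfunI)
    have s: "0 \<le> Re s"
      using that by (simp add: right_half_plane_def)
    show "blinfun_apply (?G s) (c *\<^sub>C x) = c *\<^sub>C blinfun_apply (?G s) x" for c x
      unfolding closed_loop_def op_inverse_Ko_loop[OF s]
      by (simp add: scaleC_prod_def blinfun.minus_left cblinfunD[OF H] cblinfunD[OF R]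
          cblinfunD[OF Ko_cblinfun] cblinfunD[OF Ai_cblinfun] cblinfunD[OF Ci_cblinfun[OF s]]
          flip: scaleC_minus_right)
  qed
  moreover have "bdd_above ((\<lambda>s. norm (op_remove_sings ?G s)) ` right_half_plane)"
    by (rule bdd_aboveI2[of _ _ "sqrt (norm Q)"])
      (simp add: Ko_remove_sings norm_Ko_closed_loop_le right_half_plane_def less_imp_le)
  ultimately show ?thesis
    using Ko_controller
    unfolding stabilizing_controllers_def stable_tf_def hinf_space_def by (simp add: Ko_remove_sings)
qed

lemma right_half_plane_ne: "right_half_plane \<noteq> {}"
  unfolding right_half_plane_def by (auto intro: exI[of _ 1])

lemma tf_norm_Ko_le: "tf_norm (closed_loop D A B H R (\<lambda>_. K\<^sub>o)) \<le> sqrt (norm Q)"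
  unfolding tf_norm_def hinf_norm_def
  by (rule cSUP_least[OF right_half_plane_ne])
    (simp add: Ko_remove_sings norm_Ko_closed_loop_le right_half_plane_def)

subsection \<open>The lower bound for every stabilizing controller\<close>

text \<open>The bound \<open>output_ge\<close> at points of the half-plane tending to \<open>0\<close>; the term containing \<open>s\<close> vanishes
  in the limit because stability keeps \<open>z\<close> bounded.\<close>

lemma stabilizing_tf_norm_ge:
  assumes K: "K \<in> stabilizing_controllers D A B H R"
  shows "sqrt (norm Q) \<le> tf_norm (closed_loop D A B H R K)"
proof -
  define G where "G = closed_loop D A B H R K"
  define g where "g = tf_norm G"
  have Kc: "K \<in> controllers D A B"
    and bdd: "bdd_above ((\<lambda>s. norm (op_remove_sings G s)) ` right_half_plane)"
    using K unfolding stabilizing_controllers_def stable_tf_def hinf_space_def G_def by auto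
  have G_le: "norm (op_remove_sings G s) \<le> g" if "s \<in> right_half_plane" for s
    unfolding g_def tf_norm_def hinf_norm_def using that bdd by (rule cSUP_upper)
  then have g: "0 \<le> g"
    using right_half_plane_ne by (meson all_not_in_conv norm_ge_zero order_trans)
  have "inner (blinfun_apply Q d) d \<le> g\<^sup>2 * (norm d)\<^sup>2" for d
  proof -
    define h where "h = blinfun_apply H d"
    define J where "J = inner (blinfun_apply W h) h"
    have J: "0 \<le> J"
      unfolding J_def by (rule W_nonneg)
    \<comment> \<open>Points arbitrarily close to \<open>0\<close> at which the loop is invertible and \<open>G\<close> is continuous.\<close>
    have near: "J \<le> g * norm d * sqrt J + e * (g * norm d * norm (blinfun_apply W h))"
      if e: "e > 0" for e
    proof -
      let ?p = "of_real (e / 2) :: complex"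
      have p: "?p \<in> right_half_plane"
        using e by (simp add: right_half_plane_def)
      have "open (right_half_plane \<inter> ball 0 e)"
        by (intro open_Int open_right_half_plane open_ball)
      moreover have "?p \<in> right_half_plane \<inter> ball 0 e"
        using e p by (simp add: norm_divide)
      ultimately have "\<forall>\<^sub>F s in at ?p. s \<in> right_half_plane \<inter> ball 0 e"
        by (rule eventually_at_in_open')
      moreover have "\<forall>\<^sub>F s in at ?p. has_bounded_inverse D (loop_op A B K s) \<and> op_remove_sings G s = G s"
        unfolding G_def using eventually_cosparse_imp_eventually_at[OF closed_loop_regular_cosparse[OF Kc] p] .
      ultimately have "\<forall>\<^sub>F s in at ?p. s \<in> right_half_plane \<inter> ball 0 e
          \<and> has_bounded_inverse D (loop_op A B K s) \<and> op_remove_sings G s = G s"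
        by eventually_elim blast
      then obtain s where s: "s \<in> right_half_plane" "cmod s < e"
          and inv: "has_bounded_inverse D (loop_op A B K s)" and Gs: "op_remove_sings G s = G s"
        using eventually_happens'[OF at_neq_bot] by auto
      define z where "z = blinfun_apply (op_inverse D (loop_op A B K s)) h"
      define u where "u = blinfun_apply (K s) z"
      have "blinfun_apply (G s) d = (z, blinfun_apply R u)"
        unfolding G_def closed_loop_def z_def u_def h_def by simp
      then have out: "norm (z, blinfun_apply R u) \<le> g * norm d"
        using G_le[OF s(1)] norm_blinfun[of "G s" d] mult_right_mono[of "norm (G s)" g "norm d"]
        unfolding Gs by simp
      then have nz: "norm z \<le> g * norm d"
        using norm_fst_le[of z "blinfun_apply R u"] by simp
      have "s *\<^sub>C z - A z - blinfun_apply B u = h" "z \<in> D"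
        using op_inverse_right[OF inv, of h] op_inverse_in[OF inv, of h]
        unfolding loop_op_def z_def u_def by auto
      then have "J \<le> norm (z, blinfun_apply R u) * sqrt J + cmod s * norm z * norm (blinfun_apply W h)"
        unfolding J_def by (intro output_ge)
      also have "\<dots> \<le> (g * norm d) * sqrt J + e * (g * norm d) * norm (blinfun_apply W h)"
        using out nz s(2) e J by (intro add_mono mult_right_mono mult_mono) auto
      finally show ?thesis
        by (simp add: mult.assoc)
    qed
    define k where "k = g * norm d * norm (blinfun_apply W h)"
    have k: "0 \<le> k"
      unfolding k_def using g by simp
    have "J \<le> g * norm d * sqrt J"
    proof (rule field_le_epsilon)
      fix e :: real assume e: "0 < e"
      have "e / (k + 1) * k \<le> e"
        using e k by (simp add: field_simps)
      then show "J \<le> g * norm d * sqrt J + e"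
        using near[of "e / (k + 1)"] e k unfolding k_def[symmetric] by simp
    qed
    then have "sqrt J * sqrt J \<le> (g * norm d) * sqrt J"
      using J by simp
    then have "sqrt J \<le> g * norm d"
      using g J mult_le_cancel_right_pos[of "sqrt J" "sqrt J" "g * norm d"] by (cases "J = 0") simp_all
    then have "J \<le> (g * norm d)\<^sup>2"
      using J sqrt_le_D by blast
    then show ?thesis
      unfolding Q_inner J_def h_def by (simp add: power_mult_distrib)
  qed
  then have "norm Q \<le> g\<^sup>2"
    by (intro norm_Q_le) auto
  then show ?thesis
    using g real_le_lsqrt[of g "norm Q"] unfolding g_def G_def by blast
qed

end

section \<open>The optimal attenuation problem\<close>

theorem theorem5:
  fixes A :: "'z::{complex_inner, polish_space} \<Rightarrow> 'z"
    and D\<^sub>A :: "'z set"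
    and T :: "real \<Rightarrow> 'z \<Rightarrow>\<^sub>L 'z"
    and B :: "'u::{complex_inner, polish_space} \<Rightarrow>\<^sub>L 'z"
    and H :: "'d::{complex_inner, polish_space} \<Rightarrow>\<^sub>L 'z"
    and R :: "'u \<Rightarrow>\<^sub>L 'r::{complex_inner, polish_space}"
  assumes "c0_semigroup T" and "is_generator D\<^sub>A A T"
    and "B \<in> cblinfun" and "H \<in> cblinfun" and "R \<in> cblinfun"
    and "coercive_op UNIV (blinfun_apply (cadjoint R o\<^sub>L R))"
    and "selfadjoint_op D\<^sub>A A" and "strictly_negative_op D\<^sub>A A"
  shows "let G = closed_loop D\<^sub>A A B H R;
             \<K> = stabilizing_controllers D\<^sub>A A B H R;
             K_opt = (\<lambda>s::complex. inverse_gram R o\<^sub>L cadjoint B o\<^sub>L op_inverse D\<^sub>A A);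
             M = (\<lambda>z. A (A z) + blinfun_apply (B o\<^sub>L inverse_gram R o\<^sub>L cadjoint B) z)
         in K_opt \<in> \<K> \<and>
            tf_norm (G K_opt) = (INF K\<in>\<K>. tf_norm (G K)) \<and>
            (INF K\<in>\<K>. tf_norm (G K)) =
              sqrt (norm (cadjoint H o\<^sub>L op_inverse {z \<in> D\<^sub>A. A z \<in> D\<^sub>A} M o\<^sub>L H))"
proof -
  interpret selfadjoint_plant D\<^sub>A A B H R
    using assms by unfold_locales
  let ?G = "closed_loop D\<^sub>A A B H R"
  let ?\<K> = "stabilizing_controllers D\<^sub>A A B H R"
  have inf: "(INF K\<in>?\<K>. tf_norm (?G K)) = sqrt (norm Q)"
  proof (rule cInf_eq_minimum)
    have "tf_norm (?G (\<lambda>_. K\<^sub>o)) = sqrt (norm Q)"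
      by (intro antisym tf_norm_Ko_le stabilizing_tf_norm_ge Ko_stabilizing)
    then show "sqrt (norm Q) \<in> (\<lambda>K. tf_norm (?G K)) ` ?\<K>"
      using Ko_stabilizing by (metis imageI)
  qed (auto intro: stabilizing_tf_norm_ge)
  moreover have "tf_norm (?G (\<lambda>_. K\<^sub>o)) = sqrt (norm Q)"
    by (intro antisym tf_norm_Ko_le stabilizing_tf_norm_ge Ko_stabilizing)
  moreover have "op_inverse {z \<in> D\<^sub>A. A z \<in> D\<^sub>A} (\<lambda>z. A (A z) + blinfun_apply S z) = W"
    using op_inverse_M unfolding M_def .
  ultimately show ?thesis
    using Ko_stabilizing unfolding Let_def Q_def K\<^sub>o_def S_def by (simp only: simp_thms)
qed

end
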